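(* Let $\mathcal H,\mathcal K$ be complex Hilbert spaces and let $A,B\in L(\mathcal H,\mathcal K)$ be such that $B$ is $(N(A),N(A^* ))$-complementable, and let $S:=B_{/N(A),N(A^* )}$. Write, with respect to the decompositions $\mathcal H=\overline{R(A^* )}\oplus N(A)$ and $\mathcal K=\overline{R(A)}\oplus N(A^* )$, $$A=\begin{pmatrix} a&0\\0&0\end{pmatrix},\qquad B=\begin{pmatrix} b_{11}&b_{12}\\ b_{21}&b_{22}\end{pmatrix}.$$ The following conditions are equivalent: 1. $A\overset{\diamond}{\leq}B$ (diamond order); 2. $B=\begin{pmatrix} a& xS\\ Sy& b_{22}\end{pmatrix}$ for some $y\in L(\overline{R(A^* )},N(A))$ and $x\in L(N(A^* ),\overline{R(A)})$.
   Context: $L(\mathcal H,\mathcal K)$ is the set of bounded linear operators from $\mathcal H$ to $\mathcal K$; $R(T)$ and $N(T)$ are the range and nullspace of $T$; $|T|=(T^*T)^{1/2}$; $T^\dagger$ is the (possibly unbounded) Moore-Penrose inverse. Diamond order: $A\overset{\diamond}{\leq}B$ if $R(A)\subseteq R(B)$, $R(A^* )\subseteq R(B^* )$ and $AA^*A=AB^*A$. Complementability and bilateral shorted operator: let $T\in L(\mathcal H,\mathcal K)$ and let $\mathcal M\subseteq\mathcal H$, $\mathcal N\subseteq\mathcal K$ be closed subspaces. Write $T=\begin{pmatrix} b&c\\ d&e\end{pmatrix}$ with respect to $\mathcal H=\mathcal M\oplus\mathcal M^\perp$ and $\mathcal K=\mathcal N\oplus\mathcal N^\perp$. $T$ is $(\mathcal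 M,\mathcal N)$-weakly complementable if $R(c^* )\subseteq R(|e|^{1/2})$ and $R(d)\subseteq R(|e^*|^{1/2})$; in this case the bilateral shorted operator is $$T_{/\mathcal M,\mathcal N}=\begin{pmatrix} b-g^*f&0\\0&0\end{pmatrix},\qquad f=(|e^*|^{1/2}u)^\dagger d,\quad g=(|e|^{1/2})^\dagger c^*,$$ where $e=|e^*|u$ is the polar decomposition of $e$. $T$ is $(\mathcal M,\mathcal N)$-complementable if the stronger conditions $R(c^* )\subseteq R(e^* )$ and $R(d)\subseteq R(e)$ hold (these imply weak complementability). In the matrix in condition 2, $S$ is identified with its only possibly nonzero block, an operator from $N(A)$ to $N(A^* )$. *)

theory Defs
  imports "HOL-Analysis.Analysis"
begin

section \<open>Complex Hilbert spaces\<close>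

text \<open>
  The inner product is linear in its first argument.  The library classes supply the underlying
  real structure: norm and topology are those of the complex inner product, because
  \<^term>\<open>norm x = sqrt (x \<bullet> x)\<close> holds in every \<^class>\<open>real_inner\<close> space.
\<close>

class complex_hilbert = real_inner + complete_space +
  fixes scaleC :: "complex \<Rightarrow> 'a \<Rightarrow> 'a" (infixr "*\<^sub>C" 75)
    and cinner :: "'a \<Rightarrow> 'a \<Rightarrow> complex"
  assumes scaleC_add_right: "c *\<^sub>C (x + y) = c *\<^sub>C x + c *\<^sub>C y"
    and scaleC_add_left: "(c + d) *\<^sub>C x = c *\<^sub>C x + d *\<^sub>C x"
    and scaleC_scaleC: "c *\<^sub>C d *\<^sub>C x = (c * d) *\<^sub>C x"
    and scaleR_scaleC: "r *\<^sub>R x = complex_of_real r *\<^sub>C x"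
    and cinner_add_left: "cinner (x + y) z = cinner x z + cinner y z"
    and cinner_scaleC_left: "cinner (c *\<^sub>C x) y = c * cinner x y"
    and cinner_commute: "cinner x y = cnj (cinner y x)"
    and inner_eq_Re_cinner: "x \<bullet> y = Re (cinner x y)"

instantiation complex :: complex_hilbert
begin

definition scaleC_complex :: "complex \<Rightarrow> complex \<Rightarrow> complex"
  where "scaleC_complex c x = c * x"

definition cinner_complex :: "complex \<Rightarrow> complex \<Rightarrow> complex"
  where "cinner_complex x y = x * cnj y"

instance
  by standard
    (auto simp: scaleC_complex_def cinner_complex_def inner_complex_def algebra_simps
       scaleR_conv_of_real)

end


section \<open>Bounded operators\<close>

definition bounded_clinear :: "('a::complex_hilbert \<Rightarrow> 'b::complex_hilbert) \<Rightarrow> bool"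
  where "bounded_clinear T \<longleftrightarrow> bounded_linear T \<and> (\<forall>c x. T (c *\<^sub>C x) = c *\<^sub>C T x)"

definition nullspace :: "('a::complex_hilbert \<Rightarrow> 'b::complex_hilbert) \<Rightarrow> 'a set"
  where "nullspace T = {x. T x = 0}"

definition orth :: "'a::complex_hilbert set \<Rightarrow> 'a set"
  where "orth M = {x. \<forall>y\<in>M. cinner x y = 0}"

definition proj :: "'a::complex_hilbert set \<Rightarrow> 'a \<Rightarrow> 'a"
  where "proj M x = (THE y. y \<in> M \<and> x - y \<in> orth M)"

definition cadjoint :: "('a::complex_hilbert \<Rightarrow> 'b::complex_hilbert) \<Rightarrow> 'b \<Rightarrow> 'a"
  where "cadjoint T = (THE T'. \<forall>x y. cinner (T x) y = cinner x (T' y))"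

definition positive_op :: "('a::complex_hilbert \<Rightarrow> 'a) \<Rightarrow> bool"
  where "positive_op T \<longleftrightarrow> bounded_clinear T \<and> (\<forall>x. cinner (T x) x \<in> \<real>\<^sub>\<ge>\<^sub>0)"

definition op_sqrt :: "('a::complex_hilbert \<Rightarrow> 'a) \<Rightarrow> 'a \<Rightarrow> 'a"
  where "op_sqrt T = (THE R. positive_op R \<and> R \<circ> R = T)"

definition op_abs :: "('a::complex_hilbert \<Rightarrow> 'b::complex_hilbert) \<Rightarrow> 'a \<Rightarrow> 'a"
  where "op_abs T = op_sqrt (cadjoint T \<circ> T)"

definition partial_isometry :: "('a::complex_hilbert \<Rightarrow> 'b::complex_hilbert) \<Rightarrow> bool"
  where "partial_isometry u \<longleftrightarrow>
    bounded_clinear u \<and> (\<forall>x\<in>orth (nullspace u). norm (u x) = norm x)"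

text \<open>
  The factor \<^term>\<open>u\<close> of the (left) polar decomposition \<open>T = |T\<^sup>*| u\<close>, normalised as usual by
  \<open>N(u) = N(T)\<close>.
\<close>

definition polar_factor :: "('a::complex_hilbert \<Rightarrow> 'b::complex_hilbert) \<Rightarrow> 'a \<Rightarrow> 'b"
  where "polar_factor T = (THE u. partial_isometry u \<and> nullspace u = nullspace T \<and>
    T = op_abs (cadjoint T) \<circ> u)"

text \<open>
  The Moore-Penrose inverse has domain \<open>R(T) + R(T)\<^sup>\<bottom>\<close> and sends \<open>T x + z\<close>, where
  \<open>x \<in> N(T)\<^sup>\<bottom>\<close> and \<open>z \<in> R(T)\<^sup>\<bottom>\<close>, to \<open>x\<close>.  It is unspecified outside its domain.
\<close>

definition mp_inverse :: "('a::complex_hilbert \<Rightarrow> 'b::complex_hilbert) \<Rightarrow> 'b \<Rightarrow> 'a"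
  where "mp_inverse T y = (THE x. x \<in> orth (nullspace T) \<and> y - T x \<in> orth (range T))"

definition diamond_le ::
    "('a::complex_hilbert \<Rightarrow> 'b::complex_hilbert) \<Rightarrow> ('a \<Rightarrow> 'b) \<Rightarrow> bool"
  where "diamond_le A B \<longleftrightarrow> range A \<subseteq> range B \<and> range (cadjoint A) \<subseteq> range (cadjoint B) \<and>
    A \<circ> cadjoint A \<circ> A = A \<circ> cadjoint B \<circ> A"


section \<open>Operators between closed subspaces and block matrices\<close>

text \<open>
  An operator from a closed subspace \<open>M\<close> to a closed subspace \<open>N\<close> is represented throughout by
  its extension by zero to \<open>M\<^sup>\<bottom>\<close>, viewed as an operator between the ambient spaces.  This
  identification commutes with sums, products, adjoints, square roots, moduli, polar
  decompositions (normalised as above) and Moore-Penrose inverses, and preserves ranges.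
  A block matrix is then the sum of its four entries.
\<close>

definition ops_between ::
    "'a::complex_hilbert set \<Rightarrow> 'b::complex_hilbert set \<Rightarrow> ('a \<Rightarrow> 'b) set"
  where "ops_between M N =
    {T. bounded_clinear T \<and> (\<forall>x. T x \<in> N) \<and> (\<forall>x\<in>orth M. T x = 0)}"

definition block ::
    "'a::complex_hilbert set \<Rightarrow> 'b::complex_hilbert set \<Rightarrow> ('a \<Rightarrow> 'b) \<Rightarrow> 'a \<Rightarrow> 'b"
  where "block M N T = (\<lambda>x. proj N (T (proj M x)))"

definition block_matrix ::
    "('a::complex_hilbert \<Rightarrow> 'b::complex_hilbert) \<Rightarrow> ('a \<Rightarrow> 'b) \<Rightarrow> ('a \<Rightarrow> 'b) \<Rightarrow> ('a \<Rightarrow> 'b) \<Rightarrow>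
      'a \<Rightarrow> 'b"
  where "block_matrix t11 t12 t21 t22 = (\<lambda>x. t11 x + t12 x + t21 x + t22 x)"


section \<open>Complementability and the bilateral shorted operator\<close>

text \<open>In this section \<open>M\<close> and \<open>N\<close> are meant to be closed subspaces.\<close>

definition weakly_complementable ::
    "('a::complex_hilbert \<Rightarrow> 'b::complex_hilbert) \<Rightarrow> 'a set \<Rightarrow> 'b set \<Rightarrow> bool"
  where "weakly_complementable T M N \<longleftrightarrow>
    (let c = block (orth M) N T; d = block M (orth N) T; e = block (orth M) (orth N) T
     in range (cadjoint c) \<subseteq> range (op_sqrt (op_abs e)) \<and>
        range d \<subseteq> range (op_sqrt (op_abs (cadjoint e))))"

definition complementable ::
    "('a::complex_hilbert \<Rightarrow> 'b::complex_hilbert) \<Rightarrow> 'a set \<Rightarrow> 'b set \<Rightarrow> bool"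
  where "complementable T M N \<longleftrightarrow>
    (let c = block (orth M) N T; d = block M (orth N) T; e = block (orth M) (orth N) T
     in range (cadjoint c) \<subseteq> range (cadjoint e) \<and> range d \<subseteq> range e)"

definition bilateral_shorted ::
    "('a::complex_hilbert \<Rightarrow> 'b::complex_hilbert) \<Rightarrow> 'a set \<Rightarrow> 'b set \<Rightarrow> 'a \<Rightarrow> 'b"
  where "bilateral_shorted T M N =
    (if weakly_complementable T M N then
       let b = block M N T; c = block (orth M) N T;
           d = block M (orth N) T; e = block (orth M) (orth N) T;
           u = polar_factor e;
           f = mp_inverse (op_sqrt (op_abs (cadjoint e)) \<circ> u) \<circ> d;
           g = mp_inverse (op_sqrt (op_abs e)) \<circ> cadjoint c
       in block_matrix (\<lambda>x. b x - cadjoint g (f x)) (\<lambda>_. 0) (\<lambda>_. 0) (\<lambda>_. 0)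
     else undefined)"

end

theory Submission
  imports Defs
begin

text \<open>
  Write \<open>M = N(A)\<close>, \<open>N = N(A\<^sup>*)\<close> and let \<open>b, c, d, e\<close> be the blocks of \<open>B\<close> from \<open>M\<close> to \<open>N\<close>, from
  \<open>M\<^sup>\<bottom>\<close> to \<open>N\<close>, from \<open>M\<close> to \<open>N\<^sup>\<bottom>\<close> and from \<open>M\<^sup>\<bottom>\<close> to \<open>N\<^sup>\<bottom>\<close>.  By Douglas' theorem
  complementability means \<open>d = e w\<close> and \<open>c\<^sup>* = e\<^sup>* z\<close> with bounded \<open>w\<close>, \<open>z\<close>, and then
  \<open>S = b - c w\<close> is a Schur complement.  The condition \<open>A A\<^sup>* A = A B\<^sup>* A\<close> says \<open>e = A\<close>.  Given this,
  block elimination turns \<open>R(A) \<subseteq> R(B)\<close> into \<open>R(c) \<subseteq> R(S)\<close> and, applied to the adjoints,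
  \<open>R(A\<^sup>*) \<subseteq> R(B\<^sup>*)\<close> into \<open>R(d\<^sup>*) \<subseteq> R(S\<^sup>*)\<close>; by Douglas' theorem again these are the factorisations
  \<open>c = S y\<close> and \<open>d = x S\<close>.
\<close>

subsection \<open>Inner products\<close>

text \<open>The middle condition says \<open>e = A\<close> because, tested against inner products,
  it makes \<open>B - A\<close> send the range of \<open>cadjoint A\<close> into \<open>N\<close>,
  and that range is dense in the complement of \<open>M\<close>. The elimination argument can be
  reused for adjoints because the Schur complement is self-dual: c w = \<open>cadjoint z\<close> e w
  = \<open>cadjoint z\<close> d, so \<open>cadjoint S\<close> is the Schur complement of
  \<open>cadjoint B\<close>, with \<open>z\<close> in place of \<open>w\<close>. The obstacle is
  that \<open>S\<close> is defined through |e|^(1/2), a polar factor and Moore-Penrose inverses, all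
  given by definite descriptions; existence and uniqueness must be settled before b - c w appears.
  One minimisation (Riesz on a subspace that may fail to be closed) supplies projections, adjoints
  and, on the range of an adjoint, Douglas factors. Square roots come from a strongly convergent
  iteration instead of spectral theory, and the passage from range inclusion to a norm inequality
  from uniform boundedness.\<close>

lemma cinner_add_right: "cinner x (y + z) = cinner x y + cinner x z"
  by (metis cinner_add_left cinner_commute complex_cnj_add)

lemma cinner_scaleC_right: "cinner x (c *\<^sub>C y) = cnj c * cinner x y"
  by (metis cinner_commute cinner_scaleC_left complex_cnj_mult)

lemma scaleC_minus_one: "(- 1) *\<^sub>C (x::'a::complex_hilbert) = - x"
  using scaleR_scaleC[of "-1" x] by simp

lemma cinner_minus_left: "cinner (- x) y = - cinner x y"
  using cinner_scaleC_left[of "-1" x y] by (simp add: scaleC_minus_one)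

lemma cinner_minus_right: "cinner x (- y) = - cinner x y"
  using cinner_scaleC_right[of x "-1" y] by (simp add: scaleC_minus_one)

lemma cinner_diff_left: "cinner (x - y) z = cinner x z - cinner y z"
  using cinner_add_left[of x "- y" z] by (simp add: cinner_minus_left)

lemma cinner_diff_right: "cinner x (y - z) = cinner x y - cinner x z"
  using cinner_add_right[of x y "- z"] by (simp add: cinner_minus_right)

lemma cinner_zero_left [simp]: "cinner 0 y = 0"
  using cinner_diff_left[of 0 0 y] by simp

lemma cinner_zero_right [simp]: "cinner x 0 = 0"
  using cinner_diff_right[of x 0 0] by simp

lemma cinner_scaleR_left: "cinner (r *\<^sub>R x) y = of_real r * cinner x y"
  by (simp add: scaleR_scaleC cinner_scaleC_left)

lemma cinner_scaleR_right: "cinner x (r *\<^sub>R y) = of_real r * cinner x y"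
  by (simp add: scaleR_scaleC cinner_scaleC_right)

lemma scaleC_zero_right [simp]: "c *\<^sub>C (0::'a::complex_hilbert) = 0"
  using scaleC_add_right[of c 0 "0::'a"] by simp

lemma scaleC_minus_right: "c *\<^sub>C (- x) = - (c *\<^sub>C (x::'a::complex_hilbert))"
  by (metis add.right_inverse add_eq_0_iff scaleC_add_right scaleC_zero_right)

lemma scaleC_diff_right: "c *\<^sub>C (x - y) = c *\<^sub>C x - c *\<^sub>C (y::'a::complex_hilbert)"
  using scaleC_add_right[of c x "- y"] by (simp add: scaleC_minus_right)

lemma scaleC_scaleR: "c *\<^sub>C r *\<^sub>R x = r *\<^sub>R c *\<^sub>C (x::'a::complex_hilbert)"
  by (simp add: scaleR_scaleC scaleC_scaleC mult.commute)

lemma cinner_self: "cinner x x = complex_of_real ((norm x)\<^sup>2)"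
proof (rule complex_eqI)
  show "Re (cinner x x) = Re (complex_of_real ((norm x)\<^sup>2))"
    by (simp add: inner_eq_Re_cinner[symmetric] power2_norm_eq_inner)
  have "Im (cinner x x) = - Im (cinner x x)"
    by (metis cinner_commute cnj.sel(2))
  then show "Im (cinner x x) = Im (complex_of_real ((norm x)\<^sup>2))" by simp
qed

lemma cinner_self_eq_0_iff: "cinner x x = 0 \<longleftrightarrow> x = 0"
  by (simp add: cinner_self)

lemma cinner_eq_0_commute: "cinner x y = 0 \<longleftrightarrow> cinner y x = 0"
  by (metis cinner_commute complex_cnj_zero)

lemma cinner_eqI: "(\<And>z. cinner x z = cinner y z) \<Longrightarrow> x = y"
  by (metis cinner_diff_left cinner_self_eq_0_iff eq_iff_diff_eq_0)

lemma cinner_conv_inner: "cinner x y = Complex (x \<bullet> y) (x \<bullet> (\<i> *\<^sub>C y))"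
  by (rule complex_eqI) (simp_all add: inner_eq_Re_cinner cinner_scaleC_right)

lemma norm_scaleC: "norm (c *\<^sub>C x) = cmod c * norm (x::'a::complex_hilbert)"
proof -
  have "complex_of_real ((norm (c *\<^sub>C x))\<^sup>2) = c * cnj c * cinner x x"
    by (simp only: cinner_self[symmetric] cinner_scaleC_left cinner_scaleC_right mult_ac)
  also have "\<dots> = complex_of_real ((cmod c * norm x)\<^sup>2)"
    by (simp add: cinner_self complex_norm_square[symmetric] power_mult_distrib)
  finally have "(norm (c *\<^sub>C x))\<^sup>2 = (cmod c * norm x)\<^sup>2"
    using of_real_eq_iff by blast
  then show ?thesis by simp
qed

text \<open>A unimodular factor \<open>c\<close> rotates the complex inner product onto the positive
  axis, where it equals the real one; the real Cauchy-Schwarz inequality then applies.\<close>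

lemma norm_cinner_le: "cmod (cinner x y) \<le> norm x * norm y"
proof (cases "cinner x y = 0")
  case False
  define c where "c = cnj (sgn (cinner x y))"
  have c: "cmod c = 1" using False by (simp add: c_def norm_sgn)
  have "c * cinner x y = complex_of_real (cmod (cinner x y))"
    using False by (simp add: c_def sgn_div_norm complex_norm_square[symmetric] power2_eq_square scaleR_conv_of_real field_simps)
  then have "cmod (cinner x y) = (c *\<^sub>C x) \<bullet> y"
    by (simp add: inner_eq_Re_cinner cinner_scaleC_left)
  also have "\<dots> \<le> norm (c *\<^sub>C x) * norm y" by (rule norm_cauchy_schwarz)
  finally show ?thesis by (simp add: norm_scaleC c)
qed simp

lemma bounded_bilinear_cinner:
  "bounded_bilinear (cinner :: 'a::complex_hilbert \<Rightarrow> 'a \<Rightarrow> complex)"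
proof
  show "\<exists>K. \<forall>a b::'a. norm (cinner a b) \<le> norm a * norm b * K"
    by (intro exI[of _ 1]) (simp add: norm_cinner_le)
qed (simp_all add: cinner_add_left cinner_add_right cinner_scaleR_left cinner_scaleR_right
      scaleR_conv_of_real)

lemmas tendsto_cinner [tendsto_intros] = bounded_bilinear.tendsto[OF bounded_bilinear_cinner]
lemmas continuous_on_cinner [continuous_intros] =
  bounded_bilinear.continuous_on[OF bounded_bilinear_cinner]

subsection \<open>Riesz representation and projections\<close>

text \<open>The representer minimises |v|^2 - 2 \<open>\<phi>\<close> v. Since \<open>V\<close> may
  fail to be closed, the minimising sequence converges only in the closure, which is exactly what
  the Douglas factorisation wants: there \<open>V\<close> is the range of an adjoint and its closure
  is the complement of a nullspace.\<close>

theorem riesz_on_subspace: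
  fixes V :: "'a::complex_hilbert set"
  assumes V: "subspace V"
    and add: "\<And>v w. v \<in> V \<Longrightarrow> w \<in> V \<Longrightarrow> \<phi> (v + w) = \<phi> v + \<phi> w"
    and scale: "\<And>r v. v \<in> V \<Longrightarrow> \<phi> (r *\<^sub>R v) = r * \<phi> v"
    and bound: "\<And>v. v \<in> V \<Longrightarrow> \<bar>\<phi> v\<bar> \<le> M * norm v"
    and M: "0 \<le> M"
  obtains v where "v \<in> closure V" "\<And>w. w \<in> V \<Longrightarrow> v \<bullet> w = \<phi> w" "norm v \<le> M"
proof -
  define J where "J v = (norm v)\<^sup>2 - 2 * \<phi> v" for v
  have lower: "J v \<ge> - M\<^sup>2" if "v \<in> V" for v
  proof -
    have "0 \<le> (norm v - M)\<^sup>2" by simp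
    then have "2 * (M * norm v) \<le> (norm v)\<^sup>2 + M\<^sup>2" by (simp add: power2_diff algebra_simps)
    then show ?thesis using bound[OF that] unfolding J_def by linarith
  qed
  define m where "m = Inf (J ` V)"
  have bdd: "bdd_below (J ` V)" using lower by (auto intro!: bdd_belowI)
  have ne: "J ` V \<noteq> {}" using subspace_0[OF V] by auto
  have m_le: "m \<le> J v" if "v \<in> V" for v
    unfolding m_def by (rule cInf_lower) (use bdd that in auto)
  have "\<exists>v\<in>V. J v < m + inverse (real (Suc n))" for n
  proof -
    have "Inf (J ` V) < m + inverse (real (Suc n))" by (simp add: m_def)
    then show ?thesis using cInf_lessD[OF ne] by blast
  qed
  then obtain s where s: "\<And>n. s n \<in> V" "\<And>n. J (s n) < m + inverse (real (Suc n))" by metis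
  \<comment> \<open>The parallelogram law; the linear terms of \<open>J\<close> cancel, so
    near-minimisers are close to each other.\<close>
  have par: "(norm (v - w))\<^sup>2 = 2 * J v + 2 * J w - 4 * J ((1/2) *\<^sub>R (v + w))"
    if "v \<in> V" "w \<in> V" for v w
  proof -
    have "\<phi> ((1/2) *\<^sub>R (v + w)) = (\<phi> v + \<phi> w) / 2"
      using that V by (simp add: scale add subspace_add)
    then show ?thesis
      by (simp add: J_def power2_norm_eq_inner inner_simps inner_commute field_simps)
  qed
  have close: "(norm (s i - s j))\<^sup>2 \<le> 2 * inverse (real (Suc i)) + 2 * inverse (real (Suc j))" for i j
  proof -
    have "(1/2) *\<^sub>R (s i + s j) \<in> V" using V s(1) by (simp add: subspace_add subspace_scale)
    then have "m \<le> J ((1/2) *\<^sub>R (s i + s j))" by (rule m_le)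
    then show ?thesis using par[of "s i" "s j"] s(1)[of i] s(1)[of j] s(2)[of i] s(2)[of j] by linarith
  qed
  have "Cauchy s"
  proof (rule metric_CauchyI)
    fix \<epsilon> :: real assume "\<epsilon> > 0"
    then obtain N where N: "inverse (real (Suc N)) < \<epsilon>\<^sup>2 / 4" using reals_Archimedean
      by (metis divide_pos_pos zero_less_numeral zero_less_power)
    show "\<exists>N. \<forall>i\<ge>N. \<forall>j\<ge>N. dist (s i) (s j) < \<epsilon>"
    proof (intro exI allI impI)
      fix i j assume "i \<ge> N" "j \<ge> N"
      then have "inverse (real (Suc i)) \<le> inverse (real (Suc N))"
        "inverse (real (Suc j)) \<le> inverse (real (Suc N))" by (simp_all add: field_simps)
      then have "(norm (s i - s j))\<^sup>2 < \<epsilon>\<^sup>2" using close[of i j] N by linarith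
      then show "dist (s i) (s j) < \<epsilon>"
        using \<open>\<epsilon> > 0\<close> by (simp add: dist_norm power_less_imp_less_base)
    qed
  qed
  then obtain v where v: "s \<longlonglongrightarrow> v" using Cauchy_convergent convergent_def by blast
  have vV: "v \<in> closure V" using v s(1) closure_sequential by blast
  have Js: "(\<lambda>n. J (s n)) \<longlonglongrightarrow> m"
  proof (rule tendsto_sandwich[where f = "\<lambda>_. m" and h = "\<lambda>n. m + inverse (real (Suc n))"])
    have "(\<lambda>n. m + inverse (real (Suc n))) \<longlonglongrightarrow> m + 0"
      by (intro tendsto_intros LIMSEQ_inverse_real_of_nat)
    then show "(\<lambda>n. m + inverse (real (Suc n))) \<longlonglongrightarrow> m" by simp
    show "\<forall>\<^sub>F n in sequentially. J (s n) \<le> m + inverse (real (Suc n))"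
      using s(2) by (intro always_eventually allI less_imp_le)
    show "\<forall>\<^sub>F n in sequentially. m \<le> J (s n)"
      by (intro always_eventually allI m_le s(1))
  qed (rule tendsto_const)
  have eq: "v \<bullet> w = \<phi> w" if w: "w \<in> V" for w
  proof -
    \<comment> \<open>Nothing is known about \<open>\<phi>\<close> at the limit \<open>v\<close>, so
      the members \<open>s n\<close> of \<open>V\<close> are perturbed and only the resulting
      inequality is passed to the limit.\<close>
    have quad: "0 \<le> t\<^sup>2 * (norm w)\<^sup>2 + 2 * t * (v \<bullet> w - \<phi> w)" for t
    proof -
      have "m - J (s n) \<le> t\<^sup>2 * (norm w)\<^sup>2 + 2 * t * (s n \<bullet> w - \<phi> w)" for n
      proof -
        have "m \<le> J (s n + t *\<^sub>R w)"
          using m_le V s(1) w by (simp add: subspace_add subspace_scale)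
        also have "\<dots> = J (s n) + t\<^sup>2 * (norm w)\<^sup>2 + 2 * t * (s n \<bullet> w - \<phi> w)"
        proof -
          have "\<phi> (s n + t *\<^sub>R w) = \<phi> (s n) + t * \<phi> w"
            using V w s(1)[of n] by (simp add: add scale subspace_scale)
          moreover have "(norm (s n + t *\<^sub>R w))\<^sup>2 =
              (norm (s n))\<^sup>2 + 2 * t * (s n \<bullet> w) + t\<^sup>2 * (norm w)\<^sup>2"
            using dot_norm[of "s n" "t *\<^sub>R w"] by (simp add: power_mult_distrib)
          ultimately show ?thesis unfolding J_def right_diff_distrib by linarith
        qed
        finally show ?thesis by simp
      qed
      moreover have "(\<lambda>n. m - J (s n)) \<longlonglongrightarrow> m - m" by (intro tendsto_intros Js)
      moreover have "(\<lambda>n. t\<^sup>2 * (norm w)\<^sup>2 + 2 * t * (s n \<bullet> w - \<phi> w))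
          \<longlonglongrightarrow> t\<^sup>2 * (norm w)\<^sup>2 + 2 * t * (v \<bullet> w - \<phi> w)" by (intro tendsto_intros v)
      ultimately show ?thesis
        using LIMSEQ_le[of "\<lambda>n. m - J (s n)" "m - m"] by fastforce
    qed
    show ?thesis
    proof (cases "w = 0")
      case True
      then show ?thesis using scale[OF w, of 0] by simp
    next
      case False
      define p where "p = v \<bullet> w - \<phi> w"
      \<comment> \<open>The value of t inserted here minimises the quadratic, whose minimum is then
        both nonnegative and -p^2 / |w|^2.\<close>
      have "0 \<le> (- p / (norm w)\<^sup>2)\<^sup>2 * (norm w)\<^sup>2 + 2 * (- p / (norm w)\<^sup>2) * p"
        using quad unfolding p_def by blast
      also have "\<dots> = - (p\<^sup>2 / (norm w)\<^sup>2)"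
        using False by (simp add: field_simps power2_eq_square)
      finally have "p\<^sup>2 / (norm w)\<^sup>2 \<le> 0" by simp
      then have "p = 0" using False by (simp add: divide_le_0_iff)
      then show ?thesis by (simp add: p_def)
    qed
  qed
  \<comment> \<open>The bound is extended to the closure in order to take w = v.\<close>
  have "v \<bullet> w \<le> M * norm w" if "w \<in> closure V" for w
  proof -
    have "closed {w. v \<bullet> w \<le> M * norm w}" by (intro closed_Collect_le continuous_intros)
    moreover have "V \<subseteq> {w. v \<bullet> w \<le> M * norm w}" using eq abs_le_D1[OF bound] by auto
    ultimately show ?thesis using that closure_minimal by blast
  qed
  from this[OF vV] have "norm v * norm v \<le> M * norm v"
    by (simp add: power2_norm_eq_inner[symmetric] power2_eq_square)
  then have "norm v \<le> M" using M by (cases "v = 0") (auto simp: mult_le_cancel_right)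
  with vV eq show thesis using that by blast
qed

section \<open>Complex subspaces, orthogonal complements and projections\<close>

definition csubspace :: "'a::complex_hilbert set \<Rightarrow> bool"
  where "csubspace M \<longleftrightarrow> 0 \<in> M \<and> (\<forall>x\<in>M. \<forall>y\<in>M. x + y \<in> M) \<and> (\<forall>c. \<forall>x\<in>M. c *\<^sub>C x \<in> M)"

lemma csubspace_imp_subspace: "csubspace M \<Longrightarrow> subspace M"
  by (simp add: csubspace_def subspace_def scaleR_scaleC)

lemma csubspace_diff: "csubspace M \<Longrightarrow> x \<in> M \<Longrightarrow> y \<in> M \<Longrightarrow> x - y \<in> M"
  using csubspace_imp_subspace subspace_diff by blast

lemma csubspace_orth: "csubspace (orth M)"
  by (simp add: csubspace_def orth_def cinner_add_left cinner_scaleC_left)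

lemma closed_orth: "closed (orth M)"
proof -
  have "orth M = (\<Inter>y\<in>M. {x. cinner x y = 0})" by (auto simp: orth_def)
  then show ?thesis
    by (auto intro!: closed_INT closed_Collect_eq continuous_intros)
qed

lemma orthD: "x \<in> orth M \<Longrightarrow> y \<in> M \<Longrightarrow> cinner x y = 0" "x \<in> orth M \<Longrightarrow> y \<in> M \<Longrightarrow> cinner y x = 0"
  by (auto simp: orth_def cinner_eq_0_commute)

lemma orth_Int: "x \<in> M \<Longrightarrow> x \<in> orth M \<Longrightarrow> x = 0"
  by (metis orthD(1) cinner_self_eq_0_iff)

lemma orth_closure: "orth (closure M) = orth M"
proof
  show "orth (closure M) \<subseteq> orth M" using closure_subset by (auto simp: orth_def)
  show "orth M \<subseteq> orth (closure M)"
  proof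
    fix x assume x: "x \<in> orth M"
    have "closed {y. cinner x y = 0}" by (intro closed_Collect_eq continuous_intros)
    moreover have "M \<subseteq> {y. cinner x y = 0}" using x by (auto simp: orth_def)
    ultimately have "closure M \<subseteq> {y. cinner x y = 0}" by (rule closure_minimal[rotated])
    then show "x \<in> orth (closure M)" by (auto simp: orth_def)
  qed
qed

text \<open>The imaginary part of \<open>cinner x w\<close> is the real inner product of
  \<open>x\<close> with \<open>\<i> *\<^sub>C w\<close>, and this vector lies in \<open>M\<close>
  again.\<close>

lemma inner_zero_imp_orth:
  assumes "csubspace M" and "\<And>w. w \<in> M \<Longrightarrow> x \<bullet> w = 0"
  shows "x \<in> orth M"
  using assms by (auto simp: orth_def csubspace_def cinner_conv_inner complex_eq_iff)

lemma proj_unique: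
  assumes M: "csubspace M" and "y \<in> M" "x - y \<in> orth M" "z \<in> M" "x - z \<in> orth M"
  shows "y = z"
proof -
  have "y - z \<in> M" using assms by (simp add: csubspace_diff)
  moreover have "(x - z) - (x - y) \<in> orth M" using csubspace_orth assms by (blast intro: csubspace_diff)
  ultimately show ?thesis using orth_Int by fastforce
qed

lemma proj_eqI:
  assumes "csubspace M" "y \<in> M" "x - y \<in> orth M"
  shows "proj M x = y"
  unfolding proj_def using assms proj_unique by (intro the_equality) blast+

text \<open>Riesz for the functional that takes the real inner product with \<open>x\<close>: its
  representer in \<open>M\<close> differs from \<open>x\<close> by a vector orthogonal to
  \<open>M\<close>.\<close>

lemma proj:
  assumes M: "csubspace M" "closed M"
  shows proj_in: "proj M x \<in> M" and proj_orth: "x - proj M x \<in> orth M"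
proof -
  obtain v where v: "v \<in> closure M" "\<And>w. w \<in> M \<Longrightarrow> v \<bullet> w = x \<bullet> w"
  proof (rule riesz_on_subspace[of M "\<lambda>w. x \<bullet> w" "norm x"])
    show "subspace M" using M by (simp add: csubspace_imp_subspace)
  qed (auto simp: inner_simps Cauchy_Schwarz_ineq2)
  have vM: "v \<in> M" using v(1) M by simp
  have o: "x - v \<in> orth M"
    using M v(2) by (intro inner_zero_imp_orth) (auto simp: inner_simps)
  have "proj M x = v" by (rule proj_eqI[OF M(1) vM o])
  then show "proj M x \<in> M" "x - proj M x \<in> orth M" using vM o by auto
qed

lemma orth_orth:
  assumes "csubspace M" "closed M"
  shows "orth (orth M) = M"
proof
  show "M \<subseteq> orth (orth M)" by (auto simp: orth_def intro: cinner_eq_0_commute[THEN iffD1])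
  show "orth (orth M) \<subseteq> M"
  proof
    fix x assume x: "x \<in> orth (orth M)"
    have p: "proj M x \<in> M" "x - proj M x \<in> orth M" using proj[OF assms] by auto
    then have "proj M x \<in> orth (orth M)" using \<open>M \<subseteq> orth (orth M)\<close> by auto
    then have "x - proj M x \<in> orth (orth M)" using x by (intro csubspace_diff csubspace_orth)
    then have "x - proj M x = 0" using p(2) orth_Int by blast
    then show "x \<in> M" using p by simp
  qed
qed

lemma proj_id: "csubspace M \<Longrightarrow> x \<in> M \<Longrightarrow> proj M x = x"
  by (rule proj_eqI) (simp_all add: orth_def)

lemma proj_zero: "csubspace M \<Longrightarrow> x \<in> orth M \<Longrightarrow> proj M x = 0"
  by (rule proj_eqI) (simp_all add: csubspace_def)

lemma proj_orth_compl:
  assumes "csubspace M" "closed M"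
  shows "proj (orth M) x = x - proj M x"
proof (rule proj_eqI[OF csubspace_orth])
  show "x - proj M x \<in> orth M" using proj_orth[OF assms] .
  show "x - (x - proj M x) \<in> orth (orth M)" using proj_in[OF assms] orth_orth[OF assms] by simp
qed

lemma cinner_proj_proj:
  assumes "csubspace M" "closed M"
  shows "cinner (proj M x) y = cinner (proj M x) (proj M y)"
    and "cinner x (proj M y) = cinner (proj M x) (proj M y)"
proof -
  have "cinner (proj M x) (y - proj M y) = 0" "cinner (x - proj M x) (proj M y) = 0"
    using proj[OF assms] orthD by blast+
  then show "cinner (proj M x) y = cinner (proj M x) (proj M y)"
    "cinner x (proj M y) = cinner (proj M x) (proj M y)"
    by (simp_all add: cinner_diff_left cinner_diff_right)
qed

subsection \<open>Bounded operators and adjoints\<close>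

lemma bounded_clinearI:
  assumes "\<And>x y. T (x + y) = T x + T y" "\<And>c x. T (c *\<^sub>C x) = c *\<^sub>C T x"
    and "\<And>x. norm (T x) \<le> K * norm x"
  shows "bounded_clinear T"
  unfolding bounded_clinear_def
  using assms by (auto intro!: bounded_linear_intro[of _ K] simp: scaleR_scaleC mult.commute)

lemma bounded_clinear_add: "bounded_clinear T \<Longrightarrow> T (x + y) = T x + T y"
  and bounded_clinear_diff: "bounded_clinear T \<Longrightarrow> T (x - y) = T x - T y"
  and bounded_clinear_minus: "bounded_clinear T \<Longrightarrow> T (- x) = - T x"
  and bounded_clinear_zero: "bounded_clinear T \<Longrightarrow> T 0 = 0"
  and bounded_clinear_scaleR: "bounded_clinear T \<Longrightarrow> T (r *\<^sub>R x) = r *\<^sub>R T x"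
  and bounded_clinear_scaleC: "bounded_clinear T \<Longrightarrow> T (c *\<^sub>C x) = c *\<^sub>C T x"
  unfolding bounded_clinear_def
  by (simp_all add: bounded_linear.linear linear_add linear_diff linear_neg linear_0 linear_scale)

lemmas bounded_clinear_simps = bounded_clinear_add bounded_clinear_diff bounded_clinear_minus
  bounded_clinear_zero bounded_clinear_scaleR bounded_clinear_scaleC

lemma bounded_clinear_bound:
  "bounded_clinear T \<Longrightarrow> \<exists>K>0. \<forall>x. norm (T x) \<le> K * norm x"
  using bounded_linear.pos_bounded[of T] unfolding bounded_clinear_def
  by (metis mult.commute)

lemma bounded_clinear_continuous: "bounded_clinear T \<Longrightarrow> continuous_on S T"
  unfolding bounded_clinear_def by (simp add: linear_continuous_on)

lemma bounded_clinear_compose: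
  assumes "bounded_clinear S" "bounded_clinear T"
  shows "bounded_clinear (S \<circ> T)"
  using assms bounded_linear_compose[of S T]
  by (simp add: bounded_clinear_def comp_def)

lemma bounded_clinear_plus:
  assumes "bounded_clinear S" "bounded_clinear T"
  shows "bounded_clinear (\<lambda>x. S x + T x)"
  using assms bounded_linear_add[of S T]
  by (simp add: bounded_clinear_def scaleC_add_right)

lemma bounded_clinear_sub:
  assumes "bounded_clinear S" "bounded_clinear T"
  shows "bounded_clinear (\<lambda>x. S x - T x)"
  using assms bounded_linear_sub[of S T]
  by (simp add: bounded_clinear_def scaleC_diff_right)

lemma bounded_clinear_scaleR_fun:
  assumes "bounded_clinear T"
  shows "bounded_clinear (\<lambda>x. r *\<^sub>R T x)"
  using assms bounded_linear_compose[OF bounded_linear_scaleR_right, of T r]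
  by (simp add: bounded_clinear_def scaleC_scaleR)

lemma bounded_clinear_ident: "bounded_clinear (\<lambda>x. x)"
  by (simp add: bounded_clinear_def)

lemma bounded_clinear_proj:
  assumes M: "csubspace M" "closed M"
  shows "bounded_clinear (proj M)"
proof (rule bounded_clinearI[where K = 1])
  note p = proj[OF M]
  show "proj M (x + y) = proj M x + proj M y" for x y
  proof (rule proj_eqI[OF M(1)])
    show "proj M x + proj M y \<in> M" using M(1) p(1) by (simp add: csubspace_def)
    have "(x - proj M x) + (y - proj M y) \<in> orth M"
      using csubspace_orth[of M] p(2) unfolding csubspace_def by blast
    then show "x + y - (proj M x + proj M y) \<in> orth M" by (simp add: algebra_simps)
  qed
  show "proj M (c *\<^sub>C x) = c *\<^sub>C proj M x" for c x
  proof (rule proj_eqI[OF M(1)])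
    show "c *\<^sub>C proj M x \<in> M" using M(1) p(1) by (simp add: csubspace_def)
    have "c *\<^sub>C (x - proj M x) \<in> orth M"
      using csubspace_orth[of M] p(2) unfolding csubspace_def by blast
    then show "c *\<^sub>C x - c *\<^sub>C proj M x \<in> orth M" by (simp add: scaleC_diff_right)
  qed
  show "norm (proj M x) \<le> 1 * norm x" for x
  proof -
    have "complex_of_real ((norm (proj M x))\<^sup>2) = cinner (proj M x) x"
      unfolding cinner_self[symmetric] by (rule cinner_proj_proj(1)[OF M, symmetric])
    then have "(norm (proj M x))\<^sup>2 = cmod (cinner (proj M x) x)"
      by (metis abs_of_nonneg norm_of_real zero_le_power2)
    also have "\<dots> \<le> norm (proj M x) * norm x" by (rule norm_cinner_le)
    finally show ?thesis
      by (cases "proj M x = 0") (auto simp: power2_eq_square mult_le_cancel_left)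
  qed
qed

lemma cadjoint_eqI:
  assumes "\<And>x y. cinner (T x) y = cinner x (T' y)"
  shows "cadjoint T = T'"
  unfolding cadjoint_def
proof (rule the_equality)
  fix S assume "\<forall>x y. cinner (T x) y = cinner x (S y)"
  then have "cinner (S y) x = cinner (T' y) x" for x y using assms by (metis cinner_commute)
  then show "S = T'" by (intro ext, rule cinner_eqI)
qed (use assms in blast)

text \<open>The real Riesz theorem matches only real parts; replacing x by i x then gives the
  imaginary parts. The description defining \<open>cadjoint\<close> is unique, so it denotes the map
  found this way.\<close>

lemma cinner_cadjoint:
  assumes T: "bounded_clinear T"
  shows "cinner (T x) y = cinner x (cadjoint T y)"
proof -
  obtain K where K: "0 < K" "\<And>x. norm (T x) \<le> K * norm x" using bounded_clinear_bound[OF T] by blast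
  have "\<exists>v. \<forall>w. v \<bullet> w = T w \<bullet> y" for y
  proof (rule riesz_on_subspace[of UNIV "\<lambda>w. T w \<bullet> y" "K * norm y"])
    show "\<bar>T w \<bullet> y\<bar> \<le> K * norm y * norm w" for w
      using Cauchy_Schwarz_ineq2[of "T w" y] mult_right_mono[OF K(2)[of w], of "norm y"]
      by (simp add: algebra_simps)
  qed (use K in \<open>auto simp: bounded_clinear_simps[OF T] inner_simps\<close>)
  then obtain T' where T': "\<And>y w. T' y \<bullet> w = T w \<bullet> y" by metis
  have "cinner (T x) y = cinner x (T' y)" for x y
  proof -
    have Re: "Re (cinner (T x) y) = Re (cinner x (T' y))" for x
      using T'[of y x] by (metis inner_commute inner_eq_Re_cinner)
    from Re[of "\<i> *\<^sub>C x"] Re[of x] show ?thesis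
      by (simp add: bounded_clinear_scaleC[OF T] cinner_scaleC_left complex_eq_iff)
  qed
  moreover from this have "cadjoint T = T'" by (rule cadjoint_eqI)
  ultimately show ?thesis by simp
qed

lemma cinner_cadjoint': "bounded_clinear T \<Longrightarrow> cinner y (T x) = cinner (cadjoint T y) x"
  by (metis cinner_cadjoint cinner_commute)

lemma bounded_clinear_cadjoint:
  assumes T: "bounded_clinear T"
  shows "bounded_clinear (cadjoint T)"
proof -
  obtain K where K: "0 < K" "\<And>x. norm (T x) \<le> K * norm x" using bounded_clinear_bound[OF T] by blast
  show ?thesis
  proof (rule bounded_clinearI)
    show "cadjoint T (x + y) = cadjoint T x + cadjoint T y" for x y
      by (rule cinner_eqI) (simp only: cinner_cadjoint'[OF T, symmetric] cinner_add_left)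
    show "cadjoint T (c *\<^sub>C x) = c *\<^sub>C cadjoint T x" for c x
      by (rule cinner_eqI) (simp only: cinner_cadjoint'[OF T, symmetric] cinner_scaleC_left)
    show "norm (cadjoint T y) \<le> K * norm y" for y
    proof -
      have "complex_of_real ((norm (cadjoint T y))\<^sup>2) = cinner (T (cadjoint T y)) y"
        by (simp only: cinner_self[symmetric] cinner_cadjoint[OF T])
      then have "(norm (cadjoint T y))\<^sup>2 = cmod (cinner (T (cadjoint T y)) y)"
        by (metis abs_of_nonneg norm_of_real zero_le_power2)
      also have "\<dots> \<le> norm (T (cadjoint T y)) * norm y" by (rule norm_cinner_le)
      also have "\<dots> \<le> K * norm (cadjoint T y) * norm y" by (intro mult_right_mono K(2) norm_ge_zero)
      finally have "norm (cadjoint T y) * norm (cadjoint T y) \<le> norm (cadjoint T y) * (K * norm y)"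
        by (simp add: power2_eq_square mult_ac)
      then show ?thesis
        using K(1) by (cases "cadjoint T y = 0") (simp_all add: mult_le_cancel_left)
    qed
  qed
qed

lemma cadjoint_cadjoint: "bounded_clinear T \<Longrightarrow> cadjoint (cadjoint T) = T"
  by (rule cadjoint_eqI) (simp add: cinner_cadjoint')

lemma cadjoint_compose:
  "bounded_clinear S \<Longrightarrow> bounded_clinear T \<Longrightarrow> cadjoint (S \<circ> T) = cadjoint T \<circ> cadjoint S"
  by (rule cadjoint_eqI) (simp add: cinner_cadjoint)

lemma cadjoint_sub:
  "bounded_clinear S \<Longrightarrow> bounded_clinear T \<Longrightarrow>
    cadjoint (\<lambda>x. S x - T x) = (\<lambda>x. cadjoint S x - cadjoint T x)"
  by (rule cadjoint_eqI) (simp add: cinner_cadjoint cinner_diff_left cinner_diff_right)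

section \<open>Nullspaces, ranges and the duality between them\<close>

lemma csubspace_nullspace: "bounded_clinear T \<Longrightarrow> csubspace (nullspace T)"
  by (simp add: csubspace_def nullspace_def bounded_clinear_simps)

lemma closed_nullspace: "bounded_clinear T \<Longrightarrow> closed (nullspace T)"
  unfolding nullspace_def by (intro closed_Collect_eq bounded_clinear_continuous continuous_intros)

lemma csubspace_range:
  assumes T: "bounded_clinear T" shows "csubspace (range T)"
  unfolding csubspace_def
proof (intro conjI ballI allI)
  show "0 \<in> range T" by (rule range_eqI[of _ _ 0]) (simp add: bounded_clinear_zero[OF T])
  show "x + y \<in> range T" if "x \<in> range T" "y \<in> range T" for x y
    using that by (auto simp: bounded_clinear_add[OF T, symmetric])
  show "c *\<^sub>C x \<in> range T" if "x \<in> range T" for c x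
    using that by (auto simp: bounded_clinear_scaleC[OF T, symmetric])
qed

lemma csubspace_closure:
  assumes M: "csubspace M" shows "csubspace (closure M)"
  unfolding csubspace_def
proof (intro conjI ballI allI)
  show "0 \<in> closure M" using M closure_subset[of M] by (auto simp: csubspace_def)
  show "x + y \<in> closure M" if x: "x \<in> closure M" and y: "y \<in> closure M" for x y
  proof -
    obtain s where s: "\<forall>n. s n \<in> M" "s \<longlonglongrightarrow> x" using x closure_sequential[of x M] by blast
    obtain t where t: "\<forall>n. t n \<in> M" "t \<longlonglongrightarrow> y" using y closure_sequential[of y M] by blast
    have "(\<lambda>n. s n + t n) \<longlonglongrightarrow> x + y" by (intro tendsto_add s(2) t(2))
    moreover have "\<forall>n. s n + t n \<in> M" using M s(1) t(1) by (simp add: csubspace_def)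
    ultimately show ?thesis by (intro closure_sequential[THEN iffD2] exI conjI)
  qed
  show "c *\<^sub>C x \<in> closure M" if x: "x \<in> closure M" for c x
  proof -
    obtain s where s: "\<forall>n. s n \<in> M" "s \<longlonglongrightarrow> x" using x closure_sequential[of x M] by blast
    have "bounded_clinear ((*\<^sub>C) c :: 'a \<Rightarrow> 'a)"
      by (rule bounded_clinearI[where K = "cmod c"])
        (auto simp: scaleC_add_right scaleC_scaleC norm_scaleC mult.commute)
    then have "bounded_linear ((*\<^sub>C) c :: 'a \<Rightarrow> 'a)" by (simp add: bounded_clinear_def)
    then have "(\<lambda>n. c *\<^sub>C s n) \<longlonglongrightarrow> c *\<^sub>C x" using s(2) by (rule bounded_linear.tendsto)
    moreover have "\<forall>n. c *\<^sub>C s n \<in> M" using M s(1) by (simp add: csubspace_def)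
    ultimately show ?thesis by (intro closure_sequential[THEN iffD2] exI conjI)
  qed
qed

lemma orth_range:
  assumes T: "bounded_clinear T"
  shows "orth (range T) = nullspace (cadjoint T)"
proof
  show "nullspace (cadjoint T) \<subseteq> orth (range T)"
    by (auto simp: orth_def nullspace_def cinner_cadjoint'[OF T])
  show "orth (range T) \<subseteq> nullspace (cadjoint T)"
  proof
    fix y assume "y \<in> orth (range T)"
    then have "cinner y (T (cadjoint T y)) = 0" by (simp add: orth_def)
    then show "y \<in> nullspace (cadjoint T)"
      by (simp add: cinner_cadjoint'[OF T] cinner_self_eq_0_iff nullspace_def)
  qed
qed

text \<open>The density principle of the development: a closed condition checked on the range of
  \<open>cadjoint T\<close> holds on the whole complement of the nullspace of
  \<open>T\<close>.\<close>

lemma orth_nullspace: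
  assumes T: "bounded_clinear T"
  shows "orth (nullspace T) = closure (range (cadjoint T))"
proof -
  have T': "bounded_clinear (cadjoint T)" by (rule bounded_clinear_cadjoint[OF T])
  have "orth (range (cadjoint T)) = nullspace T"
    using orth_range[OF T'] by (simp add: cadjoint_cadjoint[OF T])
  then have "orth (closure (range (cadjoint T))) = nullspace T" by (simp add: orth_closure)
  then show ?thesis
    using orth_orth[of "closure (range (cadjoint T))"] csubspace_closure[OF csubspace_range[OF T']]
    by simp
qed

subsection \<open>Uniform boundedness and Douglas factorisation\<close>

text \<open>
  Sokal's gliding hump: the step from \<open>x n\<close> to \<open>x (Suc n)\<close> has length at most \<open>3\<^sup>-\<^sup>n\<close> and makes
  \<open>\<bar>v n \<bullet> x (Suc n)\<bar> \<ge> norm (v n) / 3\<^sup>n\<close>; the later steps together undo at most half of this.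
\<close>

theorem uniform_boundedness:
  fixes F :: "'a::{real_inner,complete_space} set"
  assumes pointwise: "\<And>x. \<exists>c. \<forall>v\<in>F. \<bar>v \<bullet> x\<bar> \<le> c"
  shows "\<exists>K>0. \<forall>v\<in>F. norm v \<le> K"
proof (rule ccontr)
  assume "\<not> (\<exists>K>0. \<forall>v\<in>F. norm v \<le> K)"
  \<comment> \<open>4 beats the factor 3 of the shrinking steps: norm (v n) / 3^n exceeds (4/3)^n,
    and half of it survives in the limit.\<close>
  then have "\<exists>v\<in>F. (4::real) ^ n < norm v" for n :: nat
    by (meson not_le zero_less_numeral zero_less_power)
  then obtain v where v: "\<And>n. v n \<in> F" "\<And>n::nat. (4::real) ^ n < norm (v n)" by metis
  \<comment> \<open>The sign is that of the inner product of \<open>v n\<close> with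
    \<open>y\<close>, so the step enlarges its absolute value instead of cancelling it.\<close>
  define st where "st n y = (if v n \<bullet> y \<ge> 0 then (1/3) ^ n else - ((1/3::real) ^ n)) *\<^sub>R sgn (v n)" for n y
  define x where "x = rec_nat 0 (\<lambda>n y. y + st n y)"
  have x_Suc: "x (Suc n) = x n + st n (x n)" for n by (simp add: x_def)
  have norm_sgn_v: "norm (sgn (v n)) = 1" for n
  proof -
    have "v n \<noteq> 0" using v(2)[of n] by (metis norm_zero not_less zero_le_numeral zero_le_power)
    then show ?thesis by (simp only: norm_sgn if_False)
  qed
  have v_sgn: "v n \<bullet> sgn (v n) = norm (v n)" for n
    by (cases "v n = 0") (simp_all add: sgn_div_norm dot_square_norm power2_eq_square)
  have step: "norm (x (Suc n) - x n) = (1/3) ^ n" for n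
    by (simp add: x_Suc st_def norm_sgn_v)
  have hump: "(1/3) ^ n * norm (v n) \<le> \<bar>v n \<bullet> x (Suc n)\<bar>" for n
  proof -
    have "0 \<le> (1/3) ^ n * norm (v n)" by simp
    then show ?thesis by (auto simp: x_Suc st_def inner_add_right v_sgn)
  qed
  \<comment> \<open>The exact geometric sum is carried along because the final bound (1/3)^n / 2
    would not be inductive.\<close>
  have "norm (x (Suc n + j) - x (Suc n)) \<le> (1/3) ^ n / 2 - (1/3) ^ (n + j) / 2" for n j
  proof (induction j)
    case (Suc j)
    have "norm (x (Suc n + Suc j) - x (Suc n)) \<le>
        norm (x (Suc (Suc n + j)) - x (Suc n + j)) + norm (x (Suc n + j) - x (Suc n))"
      using norm_triangle_ineq[of "x (Suc (Suc n + j)) - x (Suc n + j)" "x (Suc n + j) - x (Suc n)"]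
      by simp
    also have "\<dots> \<le> (1/3) ^ (Suc n + j) + ((1/3) ^ n / 2 - (1/3) ^ (n + j) / 2)"
      using Suc.IH by (simp only: step add_left_mono)
    finally show ?case by simp
  qed simp
  moreover have "0 \<le> (1/3::real) ^ (n + j) / 2" for n j by simp
  ultimately have tail: "norm (x (Suc n + j) - x (Suc n)) \<le> (1/3) ^ n / 2" for n j
    by (smt (verit))
  have tail: "norm (x m - x (Suc n)) \<le> (1/3) ^ n / 2" if "m \<ge> Suc n" for m n
    using tail[of n "m - Suc n"] that by simp
  have "Cauchy x"
  proof (rule metric_CauchyI)
    fix \<epsilon> :: real assume "\<epsilon> > 0"
    then obtain n where n: "(1/3) ^ n < \<epsilon>"
      using real_arch_pow_inv[of \<epsilon> "1/3"] by auto
    show "\<exists>N. \<forall>i\<ge>N. \<forall>j\<ge>N. dist (x i) (x j) < \<epsilon>"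
    proof (intro exI allI impI)
      fix i j assume "i \<ge> Suc n" "j \<ge> Suc n"
      then have "dist (x i) (x (Suc n)) \<le> (1/3) ^ n / 2" "dist (x j) (x (Suc n)) \<le> (1/3) ^ n / 2"
        using tail by (simp_all add: dist_norm)
      then show "dist (x i) (x j) < \<epsilon>"
        using n dist_triangle2[of "x i" "x j" "x (Suc n)"] by linarith
    qed
  qed
  then obtain y where y: "x \<longlonglongrightarrow> y" using Cauchy_convergent convergent_def by blast
  have y_tail: "norm (y - x (Suc n)) \<le> (1/3) ^ n / 2" for n
  proof (rule tendsto_upperbound)
    show "(\<lambda>m. norm (x m - x (Suc n))) \<longlonglongrightarrow> norm (y - x (Suc n))" by (intro tendsto_intros y)
    show "\<forall>\<^sub>F m in sequentially. norm (x m - x (Suc n)) \<le> (1/3) ^ n / 2"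
      using eventually_ge_at_top[of "Suc n"] by (rule eventually_mono) (rule tail)
  qed simp
  have big: "(4/3) ^ n \<le> 2 * \<bar>v n \<bullet> y\<bar>" for n
  proof -
    have "\<bar>v n \<bullet> (y - x (Suc n))\<bar> \<le> norm (v n) * ((1/3) ^ n / 2)"
      using Cauchy_Schwarz_ineq2[of "v n" "y - x (Suc n)"] mult_left_mono[OF y_tail norm_ge_zero]
      by (rule order_trans)
    also have "\<dots> = (1/3) ^ n * norm (v n) / 2" by simp
    finally have "\<bar>v n \<bullet> (y - x (Suc n))\<bar> \<le> (1/3) ^ n * norm (v n) / 2" .
    moreover have "v n \<bullet> y = v n \<bullet> x (Suc n) + v n \<bullet> (y - x (Suc n))"
      by (simp add: inner_diff_right)
    ultimately have "(1/3) ^ n * norm (v n) \<le> 2 * \<bar>v n \<bullet> y\<bar>"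
      using hump[of n] by linarith
    moreover have "(4/3::real) ^ n \<le> (1/3) ^ n * norm (v n)"
      using mult_left_mono[OF less_imp_le[OF v(2)[of n]], of "(1/3) ^ n"]
      by (simp add: power_mult_distrib[symmetric])
    ultimately show ?thesis by linarith
  qed
  obtain c where c: "\<forall>w\<in>F. \<bar>w \<bullet> y\<bar> \<le> c" using pointwise by blast
  obtain n where "2 * c < (4/3::real) ^ n" using real_arch_pow[of "4/3" "2 * c"] by auto
  moreover have "\<bar>v n \<bullet> y\<bar> \<le> c" using c v(1) by blast
  ultimately show False using big[of n] by linarith
qed

lemma inner_cadjoint: "bounded_clinear T \<Longrightarrow> T x \<bullet> y = x \<bullet> cadjoint T y"
  by (simp add: inner_eq_Re_cinner cinner_cadjoint)

text \<open>Solutions in the complement of the nullspace are unique; this makes pointwise chosen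
  Douglas solutions linear and identifies the values of the Moore-Penrose inverse.\<close>

lemma nullspace_orth_inj:
  assumes T: "bounded_clinear T" and "x \<in> orth (nullspace T)" "y \<in> orth (nullspace T)" "T x = T y"
  shows "x = y"
proof -
  have "x - y \<in> orth (nullspace T)" using assms by (blast intro: csubspace_diff csubspace_orth)
  moreover have "x - y \<in> nullspace T" using assms by (simp add: nullspace_def bounded_clinear_diff)
  ultimately have "x - y = 0" by (blast intro: orth_Int)
  then show ?thesis by simp
qed

text \<open>For fixed x, sending \<open>cadjoint D k\<close> to the inner product of k with C x is a
  functional of norm at most K |x|. Its Riesz representer solves D v = C x inside the complement of
  the nullspace of D. The explicit constant is kept because the polar factor needs K = 1.\<close>

theorem douglas_majorization:
  fixes C :: "'a::complex_hilbert \<Rightarrow> 'c::complex_hilbert" and D :: "'b::complex_hilbert \<Rightarrow> 'c"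
  assumes C: "bounded_clinear C" and D: "bounded_clinear D" and K: "0 \<le> K"
    and le: "\<And>k. norm (cadjoint C k) \<le> K * norm (cadjoint D k)"
  obtains W where "bounded_clinear W" "C = D \<circ> W" "\<And>x. W x \<in> orth (nullspace D)"
    "\<And>x. norm (W x) \<le> K * norm x"
proof -
  note D' = bounded_clinear_cadjoint[OF D] and C' = bounded_clinear_cadjoint[OF C]
  have "\<exists>v. v \<in> orth (nullspace D) \<and> D v = C x \<and> norm v \<le> K * norm x" for x
  proof -
    \<comment> \<open>The choice of preimage does not matter: \<open>le\<close> forces
      \<open>cadjoint C\<close> to vanish wherever \<open>cadjoint D\<close> does.\<close>
    define \<phi> where "\<phi> w = (SOME k. cadjoint D k = w) \<bullet> C x" for w
    have \<phi>: "\<phi> (cadjoint D k) = k \<bullet> C x" for k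
    proof -
      define k' where "k' = (SOME k'. cadjoint D k' = cadjoint D k)"
      have "cadjoint D k' = cadjoint D k" unfolding k'_def by (rule someI) (rule refl)
      then have "cadjoint C (k' - k) = 0"
        using le[of "k' - k"] by (simp add: bounded_clinear_diff[OF D'])
      then have "(k' - k) \<bullet> C x = 0"
        using inner_cadjoint[OF C, of x "k' - k"] by (simp add: inner_commute)
      then show ?thesis by (simp add: \<phi>_def k'_def inner_diff_left)
    qed
    obtain v where v: "v \<in> closure (range (cadjoint D))"
      "\<And>w. w \<in> range (cadjoint D) \<Longrightarrow> v \<bullet> w = \<phi> w" "norm v \<le> K * norm x"
    proof (rule riesz_on_subspace[of "range (cadjoint D)" \<phi> "K * norm x"])
      show "subspace (range (cadjoint D))"
        using csubspace_imp_subspace csubspace_range D' by blast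
      show "\<phi> (v + w) = \<phi> v + \<phi> w" if "v \<in> range (cadjoint D)" "w \<in> range (cadjoint D)" for v w
        using that by (auto simp: bounded_clinear_add[OF D', symmetric] \<phi> inner_add_left)
      show "\<phi> (r *\<^sub>R v) = r * \<phi> v" if "v \<in> range (cadjoint D)" for r v
        using that by (auto simp: bounded_clinear_scaleR[OF D', symmetric] \<phi>)
      show "\<bar>\<phi> v\<bar> \<le> K * norm x * norm v" if v: "v \<in> range (cadjoint D)" for v
      proof -
        obtain k where k: "v = cadjoint D k" using v by blast
        have "\<bar>\<phi> v\<bar> = \<bar>x \<bullet> cadjoint C k\<bar>"
          by (simp add: k \<phi> inner_cadjoint[OF C, symmetric] inner_commute)
        also have "\<dots> \<le> norm x * norm (cadjoint C k)" by (rule Cauchy_Schwarz_ineq2)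
        also have "\<dots> \<le> norm x * (K * norm v)" unfolding k by (intro mult_left_mono le norm_ge_zero)
        finally show ?thesis by (simp add: mult_ac)
      qed
    qed (use K in auto)
    have "D v \<bullet> k = C x \<bullet> k" for k
      using v(2)[of "cadjoint D k"] inner_cadjoint[OF D, of v k] \<phi>[of k]
      by (simp add: inner_commute[of k])
    then have "D v = C x" by (metis inner_commute vector_eq_rdot)
    then show ?thesis using v(1,3) orth_nullspace[OF D] by blast
  qed
  then obtain W where W: "\<And>x. W x \<in> orth (nullspace D)" "\<And>x. D (W x) = C x"
    "\<And>x. norm (W x) \<le> K * norm x" by metis
  have "bounded_clinear W"
  proof (rule bounded_clinearI)
    show "norm (W x) \<le> K * norm x" for x by (rule W(3))
    show "W (x + y) = W x + W y" for x y
    proof (rule nullspace_orth_inj[OF D W(1)])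
      show "W x + W y \<in> orth (nullspace D)"
        using csubspace_orth[of "nullspace D"] W(1) by (simp add: csubspace_def)
      show "D (W (x + y)) = D (W x + W y)"
        by (simp add: W(2) bounded_clinear_add[OF C] bounded_clinear_add[OF D])
    qed
    show "W (c *\<^sub>C x) = c *\<^sub>C W x" for c x
    proof (rule nullspace_orth_inj[OF D W(1)])
      show "c *\<^sub>C W x \<in> orth (nullspace D)"
        using csubspace_orth[of "nullspace D"] W(1) by (simp add: csubspace_def)
      show "D (W (c *\<^sub>C x)) = D (c *\<^sub>C W x)"
        by (simp add: W(2) bounded_clinear_scaleC[OF C] bounded_clinear_scaleC[OF D])
    qed
  qed
  moreover have "C = D \<circ> W" using W(2) by auto
  ultimately show thesis using W(1,3) that by blast
qed

text \<open>Uniform boundedness converts the inclusion into the majorisation. At each x the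
  normalised vectors in \<open>F\<close> are bounded by the norm of any w with D w = C x.\<close>

theorem douglas:
  fixes C :: "'a::complex_hilbert \<Rightarrow> 'c::complex_hilbert" and D :: "'b::complex_hilbert \<Rightarrow> 'c"
  assumes C: "bounded_clinear C" and D: "bounded_clinear D" and sub: "range C \<subseteq> range D"
  obtains W where "bounded_clinear W" "C = D \<circ> W" "\<And>x. W x \<in> orth (nullspace D)"
proof -
  define F where "F = {inverse (norm (cadjoint D k)) *\<^sub>R cadjoint C k |k. cadjoint D k \<noteq> 0}"
  have dual: "\<bar>cadjoint C k \<bullet> x\<bar> \<le> norm w * norm (cadjoint D k)" if "D w = C x" for k x w
  proof -
    have "cadjoint C k \<bullet> x = w \<bullet> cadjoint D k"
      using that by (metis inner_cadjoint[OF C] inner_cadjoint[OF D] inner_commute)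
    then show ?thesis by (simp add: Cauchy_Schwarz_ineq2)
  qed
  have lift: "\<exists>w. D w = C x" for x using sub by (metis imageE rangeI subsetD)
  have "\<exists>c. \<forall>v\<in>F. \<bar>v \<bullet> x\<bar> \<le> c" for x
  proof -
    obtain w where w: "D w = C x" using lift by blast
    have "\<bar>v \<bullet> x\<bar> \<le> norm w" if v: "v \<in> F" for v
    proof -
      obtain k where k: "v = inverse (norm (cadjoint D k)) *\<^sub>R cadjoint C k" "cadjoint D k \<noteq> 0"
        using v by (auto simp: F_def)
      then show ?thesis using dual[OF w, of k] by (simp add: abs_mult field_simps)
    qed
    then show ?thesis by blast
  qed
  then obtain K where K: "0 < K" "\<And>v. v \<in> F \<Longrightarrow> norm v \<le> K"
    using uniform_boundedness[of F] by blast
  have le: "norm (cadjoint C k) \<le> K * norm (cadjoint D k)" for k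
  proof (cases "cadjoint D k = 0")
    case True
    \<comment> \<open>Here the bound demands \<open>cadjoint C k = 0\<close>; \<open>dual\<close> at
      the point \<open>cadjoint C k\<close> gives that its squared norm is at most 0.\<close>
    obtain w where "D w = C (cadjoint C k)" using lift by blast
    from dual[OF this, of k] True show ?thesis by (simp add: dot_square_norm)
  next
    case False
    then have "norm (inverse (norm (cadjoint D k)) *\<^sub>R cadjoint C k) \<le> K"
      by (intro K(2)) (auto simp: F_def)
    with False show ?thesis by (simp add: field_simps)
  qed
  show thesis
    by (rule douglas_majorization[OF C D less_imp_le[OF K(1)] le]) (rule that)
qed

subsection \<open>Positive operators and their square roots\<close>

lemma nonneg_Reals_cinner_iff:
  "cinner x y \<in> \<real>\<^sub>\<ge>\<^sub>0 \<longleftrightarrow> 0 \<le> x \<bullet> y \<and> Im (cinner x y) = 0"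
  by (simp add: complex_nonneg_Reals_iff inner_eq_Re_cinner)

lemma positive_op_bounded: "positive_op T \<Longrightarrow> bounded_clinear T"
  by (simp add: positive_op_def)

lemma positive_op_inner: "positive_op T \<Longrightarrow> 0 \<le> T x \<bullet> x"
  by (simp add: positive_op_def nonneg_Reals_cinner_iff)

text \<open>Polarisation: the quadratic form is real at x + y and at x + i y, which fixes the
  imaginary and the real part of the two mixed terms.\<close>

lemma positive_op_selfadjoint:
  assumes T: "positive_op T"
  shows "cinner (T x) y = cinner x (T y)"
proof -
  note lin = bounded_clinear_simps[OF positive_op_bounded[OF T]]
  have real: "Im (cinner (T z) z) = 0" for z
    using T by (simp add: positive_op_def nonneg_Reals_cinner_iff)
  have "Im (cinner (T x) y) + Im (cinner (T y) x) = 0"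
    using real[of "x + y"] real[of x] real[of y]
    by (simp add: lin cinner_add_left cinner_add_right)
  moreover have "Re (cinner (T x) y) = Re (cinner (T y) x)"
    using real[of "x + \<i> *\<^sub>C y"] real[of x] real[of y]
    by (simp add: lin cinner_add_left cinner_add_right cinner_scaleC_left cinner_scaleC_right)
  ultimately have "cinner (T x) y = cnj (cinner (T y) x)" by (simp add: complex_eq_iff)
  then show ?thesis using cinner_commute by metis
qed

lemma selfadjoint_positive_op:
  assumes "bounded_clinear T" "\<And>x y. cinner (T x) y = cinner x (T y)" "\<And>x. 0 \<le> T x \<bullet> x"
  shows "positive_op T"
proof -
  have "Im (cinner (T x) x) = 0" for x
    using assms(2)[of x x] cinner_commute[of "T x" x] by (simp add: complex_eq_iff)
  then show ?thesis unfolding positive_op_def nonneg_Reals_cinner_iff using assms(1,3) by blast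
qed

text \<open>The first inequality comes from positivity of T at the vector x - T x. The second makes
  1 - T a contraction, as the square root iteration requires.\<close>

lemma positive_contraction:
  assumes T: "positive_op T" and le: "\<And>x. norm (T x) \<le> norm x"
  shows "norm (T x) ^ 2 \<le> T x \<bullet> x" and "norm (x - T x) \<le> norm x"
proof -
  note lin = bounded_clinear_simps[OF positive_op_bounded[OF T]]
  have sa: "T (T x) \<bullet> x = T x \<bullet> T x"
    using positive_op_selfadjoint[OF T, of "T x" x] by (simp add: inner_eq_Re_cinner)
  have "0 \<le> T (x - T x) \<bullet> (x - T x)" by (rule positive_op_inner[OF T])
  also have "\<dots> = T x \<bullet> x - 2 * (T x \<bullet> T x) + T (T x) \<bullet> T x"
    by (simp add: lin inner_diff_left inner_diff_right sa)
  also have "T (T x) \<bullet> T x \<le> norm (T (T x)) * norm (T x)" by (rule norm_cauchy_schwarz)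
  also have "\<dots> \<le> norm (T x) * norm (T x)" by (intro mult_right_mono le norm_ge_zero)
  also have "\<dots> = T x \<bullet> T x" by (simp add: dot_square_norm power2_eq_square)
  finally show 1: "norm (T x) ^ 2 \<le> T x \<bullet> x" by (simp add: dot_square_norm)
  have "(norm (x - T x))\<^sup>2 = (norm x)\<^sup>2 + (norm (T x))\<^sup>2 - 2 * (T x \<bullet> x)"
    by (simp add: power2_norm_eq_inner inner_diff_left inner_diff_right inner_commute)
  also have "\<dots> \<le> (norm x)\<^sup>2" using 1 zero_le_power2[of "norm (T x)"] by linarith
  finally show "norm (x - T x) \<le> norm x" by (rule power2_le_imp_le) simp
qed

lemma positive_op_scaleR:
  assumes "positive_op T" "0 \<le> r" shows "positive_op (\<lambda>x. r *\<^sub>R T x)"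
proof (rule selfadjoint_positive_op)
  show "bounded_clinear (\<lambda>x. r *\<^sub>R T x)"
    by (rule bounded_clinear_scaleR_fun[OF positive_op_bounded[OF assms(1)]])
  show "cinner (r *\<^sub>R T x) y = cinner x (r *\<^sub>R T y)" for x y
    by (simp add: cinner_scaleR_left cinner_scaleR_right positive_op_selfadjoint[OF assms(1)])
  show "0 \<le> (r *\<^sub>R T x) \<bullet> x" for x using positive_op_inner[OF assms(1)] assms(2) by simp
qed

lemma positive_op_contraction_scale:
  assumes T: "positive_op T"
  obtains K where "0 < K" "positive_op (\<lambda>x. inverse K *\<^sub>R T x)"
    "\<And>x. norm (inverse K *\<^sub>R T x) \<le> norm x"
proof -
  obtain K where K: "0 < K" "\<And>x. norm (T x) \<le> K * norm x"
    using bounded_clinear_bound[OF positive_op_bounded[OF T]] by blast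
  have "norm (inverse K *\<^sub>R T x) \<le> norm x" for x
    using K(2)[of x] K(1) by (simp add: field_simps)
  then show thesis using K(1) positive_op_scaleR[OF T, of "inverse K"] by (intro that) auto
qed

lemma positive_op_inner_eq_0:
  assumes T: "positive_op T" and "T x \<bullet> x = 0"
  shows "T x = 0"
proof -
  obtain K where K: "0 < K" "positive_op (\<lambda>x. inverse K *\<^sub>R T x)"
    "\<And>x. norm (inverse K *\<^sub>R T x) \<le> norm x"
    using positive_op_contraction_scale[OF T] by blast
  have "norm (inverse K *\<^sub>R T x) ^ 2 \<le> (inverse K *\<^sub>R T x) \<bullet> x"
    by (rule positive_contraction(1)[OF K(2,3)])
  then show ?thesis using assms(2) K(1) by simp
qed

text \<open>
  The fixed point \<open>Y = (X + Y\<^sup>2) / 2\<close> gives \<open>(1 - Y)\<^sup>2 = 1 - X\<close>.  The iteration is dominated, step by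
  step, by the same iteration for the scalar \<open>X = 1\<close>, which increases and is bounded by 1.
\<close>

primrec sqrt_iter :: "('a::complex_hilbert \<Rightarrow> 'a) \<Rightarrow> nat \<Rightarrow> 'a \<Rightarrow> 'a" where
  "sqrt_iter X 0 = (\<lambda>_. 0)"
| "sqrt_iter X (Suc n) = (\<lambda>x. (1/2) *\<^sub>R (X x + sqrt_iter X n (sqrt_iter X n x)))"

primrec sqrt_majorant :: "nat \<Rightarrow> real" where
  "sqrt_majorant 0 = 0"
| "sqrt_majorant (Suc n) = (1 + (sqrt_majorant n)\<^sup>2) / 2"

lemma sqrt_majorant_bounds: "0 \<le> sqrt_majorant n" "sqrt_majorant n \<le> 1"
proof (induction n)
  case (Suc n)
  have "(sqrt_majorant n)\<^sup>2 \<le> 1" using Suc by (simp add: power_le_one)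
  then show "0 \<le> sqrt_majorant (Suc n)" "sqrt_majorant (Suc n) \<le> 1"
    by simp_all
qed simp_all

lemma sqrt_majorant_mono: "incseq sqrt_majorant"
proof (rule incseq_SucI)
  fix n
  have "0 \<le> (1 - sqrt_majorant n)\<^sup>2" by simp
  then show "sqrt_majorant n \<le> sqrt_majorant (Suc n)" by (simp add: power2_diff)
qed

lemma Cauchy_sqrt_majorant: "Cauchy sqrt_majorant"
proof -
  obtain l where "sqrt_majorant \<longlonglongrightarrow> l"
    by (rule incseq_convergent[OF sqrt_majorant_mono, of 1]) (use sqrt_majorant_bounds(2) in blast)+
  then show ?thesis by (rule LIMSEQ_imp_Cauchy)
qed

lemma bounded_clinear_limit:
  assumes F: "\<And>n. bounded_clinear (F n)" and b: "\<And>n x. norm (F n x) \<le> K * norm x"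
    and lim: "\<And>x. (\<lambda>n. F n x) \<longlonglongrightarrow> G x"
  shows "bounded_clinear G" and "norm (G x) \<le> K * norm x"
proof -
  show le: "norm (G x) \<le> K * norm x" for x
    by (rule LIMSEQ_le_const2[OF tendsto_norm[OF lim]]) (use b in blast)
  show "bounded_clinear G"
  proof (rule bounded_clinearI[OF _ _ le])
    show "G (x + y) = G x + G y" for x y
    proof (rule LIMSEQ_unique[OF lim])
      show "(\<lambda>n. F n (x + y)) \<longlonglongrightarrow> G x + G y"
        by (simp only: bounded_clinear_add[OF F]) (intro tendsto_add lim)
    qed
    show "G (c *\<^sub>C x) = c *\<^sub>C G x" for c x
    proof (rule LIMSEQ_unique[OF lim])
      have "bounded_linear ((*\<^sub>C) c :: 'b \<Rightarrow> 'b)"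
        by (rule bounded_linear_intro[of _ "cmod c"])
          (simp_all add: scaleC_add_right scaleC_scaleR norm_scaleC)
      then show "(\<lambda>n. F n (c *\<^sub>C x)) \<longlonglongrightarrow> c *\<^sub>C G x"
        by (simp only: bounded_clinear_scaleC[OF F]) (rule bounded_linear.tendsto[OF _ lim])
    qed
  qed
qed

context
  fixes X :: "'a::complex_hilbert \<Rightarrow> 'a"
  assumes X: "bounded_clinear X" and X_sa: "\<And>x y. cinner (X x) y = cinner x (X y)"
    and X_le: "\<And>x. norm (X x) \<le> norm x"
begin

lemma bounded_clinear_sqrt_iter: "bounded_clinear (sqrt_iter X n)"
proof (induction n)
  case 0
  show ?case by (rule bounded_clinearI[where K = 0]) simp_all
next
  case (Suc n)
  have "bounded_clinear (\<lambda>x. X x + (sqrt_iter X n \<circ> sqrt_iter X n) x)"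
    by (intro bounded_clinear_plus X bounded_clinear_compose Suc)
  then show ?case using bounded_clinear_scaleR_fun[of _ "1/2"] by (simp add: comp_def)
qed

lemma sqrt_iter_le: "norm (sqrt_iter X n x) \<le> sqrt_majorant n * norm x"
proof (induction n arbitrary: x)
  case (Suc n)
  have "norm (sqrt_iter X n (sqrt_iter X n x)) \<le> sqrt_majorant n * norm (sqrt_iter X n x)"
    by (rule Suc)
  also have "\<dots> \<le> sqrt_majorant n * (sqrt_majorant n * norm x)"
    by (intro mult_left_mono Suc sqrt_majorant_bounds)
  finally have "norm (X x + sqrt_iter X n (sqrt_iter X n x)) \<le> norm x + sqrt_majorant n * (sqrt_majorant n * norm x)"
    using X_le norm_triangle_mono by blast
  then show ?case by (simp add: power2_eq_square distrib_right mult.assoc)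
qed simp

text \<open>For consecutive iterates, Z^2 - Y^2 = Z (Z - Y) + (Z - Y) Y mirrors q^2 - p^2 = q (q -
  p) + (q - p) p term by term, so the scalar increments dominate.\<close>

lemma sqrt_iter_step:
  "norm (sqrt_iter X (Suc n) x - sqrt_iter X n x) \<le> (sqrt_majorant (Suc n) - sqrt_majorant n) * norm x"
proof (induction n arbitrary: x)
  case 0
  show ?case using X_le[of x] by simp
next
  case (Suc n)
  define Y where "Y = sqrt_iter X n"
  define Z where "Z = sqrt_iter X (Suc n)"
  define p where "p = sqrt_majorant n"
  define q where "q = sqrt_majorant (Suc n)"
  have Y: "bounded_clinear Y" and Z: "bounded_clinear Z"
    unfolding Y_def Z_def by (rule bounded_clinear_sqrt_iter)+
  have IH: "norm (Z x - Y x) \<le> (q - p) * norm x" for x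
    using Suc unfolding Y_def Z_def p_def q_def .
  have pq: "0 \<le> p" "0 \<le> q" "p \<le> q"
    using sqrt_majorant_bounds incseqD[OF sqrt_majorant_mono, of n "Suc n"] by (simp_all add: p_def q_def)
  have "norm (Z (Z x - Y x)) \<le> q * norm (Z x - Y x)"
    unfolding Z_def q_def by (rule sqrt_iter_le)
  also have "\<dots> \<le> q * ((q - p) * norm x)" by (intro mult_left_mono IH pq)
  finally have 1: "norm (Z (Z x - Y x)) \<le> q * ((q - p) * norm x)" .
  have "norm (Z (Y x) - Y (Y x)) \<le> (q - p) * norm (Y x)" by (rule IH)
  also have "\<dots> \<le> (q - p) * (p * norm x)"
    using pq sqrt_iter_le[of n x] by (intro mult_left_mono) (simp_all add: Y_def p_def)
  finally have 2: "norm (Z (Y x) - Y (Y x)) \<le> (q - p) * (p * norm x)" .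
  have eq: "Z (Z x) - Y (Y x) = Z (Z x - Y x) + (Z (Y x) - Y (Y x))"
    by (simp add: bounded_clinear_diff[OF Z])
  have "norm (Z (Z x) - Y (Y x)) \<le> q * ((q - p) * norm x) + (q - p) * (p * norm x)"
    unfolding eq by (rule norm_triangle_mono[OF 1 2])
  also have "\<dots> = (q\<^sup>2 - p\<^sup>2) * norm x" by (simp add: power2_eq_square algebra_simps)
  finally have le: "norm (Z (Z x) - Y (Y x)) \<le> (q\<^sup>2 - p\<^sup>2) * norm x" .
  have "sqrt_iter X (Suc (Suc n)) x = (1/2) *\<^sub>R (X x + Z (Z x))" by (simp only: sqrt_iter.simps Z_def)
  moreover have "sqrt_iter X (Suc n) x = (1/2) *\<^sub>R (X x + Y (Y x))" by (simp only: sqrt_iter.simps Y_def)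
  ultimately have "norm (sqrt_iter X (Suc (Suc n)) x - sqrt_iter X (Suc n) x) =
      norm (Z (Z x) - Y (Y x)) / 2"
    by (simp add: scaleR_diff_right[symmetric] del: sqrt_iter.simps)
  moreover have "sqrt_majorant (Suc (Suc n)) = (1 + q\<^sup>2) / 2" "sqrt_majorant (Suc n) = (1 + p\<^sup>2) / 2"
    by (simp_all only: sqrt_majorant.simps q_def p_def)
  ultimately show ?case using le by (simp add: left_diff_distrib diff_divide_distrib add_divide_distrib distrib_right del: sqrt_iter.simps sqrt_majorant.simps)
qed

lemma sqrt_iter_diff:
  assumes "m \<le> n"
  shows "norm (sqrt_iter X n x - sqrt_iter X m x) \<le> (sqrt_majorant n - sqrt_majorant m) * norm x"
  using assms
proof (induction n rule: dec_induct)
  case (step n)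
  have "sqrt_iter X (Suc n) x - sqrt_iter X m x =
      (sqrt_iter X (Suc n) x - sqrt_iter X n x) + (sqrt_iter X n x - sqrt_iter X m x)" by simp
  also have "norm \<dots> \<le> (sqrt_majorant (Suc n) - sqrt_majorant n) * norm x +
      (sqrt_majorant n - sqrt_majorant m) * norm x"
    by (rule norm_triangle_mono[OF sqrt_iter_step step.IH])
  finally show ?case by (simp only: left_diff_distrib)
qed simp

definition sqrt_lim :: "'a \<Rightarrow> 'a" where "sqrt_lim x = lim (\<lambda>n. sqrt_iter X n x)"

lemma sqrt_iter_tendsto: "(\<lambda>n. sqrt_iter X n x) \<longlonglongrightarrow> sqrt_lim x"
proof -
  have "Cauchy (\<lambda>n. sqrt_iter X n x)"
  proof (rule metric_CauchyI)
    fix \<epsilon> :: real assume \<epsilon>: "\<epsilon> > 0"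
    have pos: "0 < \<epsilon> / (norm x + 1)" using \<epsilon> by (simp add: add_nonneg_pos)
    obtain N where N: "\<And>m n. m \<ge> N \<Longrightarrow> n \<ge> N \<Longrightarrow>
        dist (sqrt_majorant m) (sqrt_majorant n) < \<epsilon> / (norm x + 1)"
      using metric_CauchyD[OF Cauchy_sqrt_majorant pos] by blast
    have le: "dist (sqrt_iter X m x) (sqrt_iter X n x) < \<epsilon>" if "N \<le> m" "m \<le> n" for m n
    proof -
      have "norm (sqrt_iter X n x - sqrt_iter X m x) \<le> (sqrt_majorant n - sqrt_majorant m) * norm x"
        using that(2) by (rule sqrt_iter_diff)
      also have "\<dots> \<le> \<epsilon> / (norm x + 1) * norm x"
        using N[of n m] that by (intro mult_right_mono) (simp_all add: dist_real_def)
      also have "\<dots> < \<epsilon> / (norm x + 1) * (norm x + 1)"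
        using pos by (intro mult_strict_left_mono) simp_all
      also have "\<dots> = \<epsilon>" by (simp add: add_nonneg_eq_0_iff)
      finally show ?thesis by (simp add: dist_norm norm_minus_commute)
    qed
    show "\<exists>N. \<forall>m\<ge>N. \<forall>n\<ge>N. dist (sqrt_iter X m x) (sqrt_iter X n x) < \<epsilon>"
    proof (intro exI allI impI)
      fix m n assume "m \<ge> N" "n \<ge> N"
      then show "dist (sqrt_iter X m x) (sqrt_iter X n x) < \<epsilon>"
        using le[of m n] le[of n m] by (cases "m \<le> n") (simp_all add: dist_commute)
    qed
  qed
  then show ?thesis unfolding sqrt_lim_def by (simp add: Cauchy_convergent convergent_LIMSEQ_iff[symmetric])
qed

lemma sqrt_iter_contraction: "norm (sqrt_iter X n x) \<le> norm x"
  using sqrt_iter_le[of n x] mult_right_mono[OF sqrt_majorant_bounds(2)[of n] norm_ge_zero[of x]]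
  by simp

lemma bounded_clinear_sqrt_lim: "bounded_clinear sqrt_lim"
  and sqrt_lim_le: "norm (sqrt_lim x) \<le> norm x"
proof -
  have "norm (sqrt_iter X n x) \<le> 1 * norm x" for n x by (simp add: sqrt_iter_contraction)
  note lim = bounded_clinear_limit[OF bounded_clinear_sqrt_iter this sqrt_iter_tendsto]
  show "bounded_clinear sqrt_lim" by (rule lim(1))
  show "norm (sqrt_lim x) \<le> norm x" using lim(2)[of x] by simp
qed

lemma sqrt_lim_selfadjoint: "cinner (sqrt_lim x) y = cinner x (sqrt_lim y)"
proof -
  have sa: "cinner (sqrt_iter X n x) y = cinner x (sqrt_iter X n y)" for n x y
    by (induction n arbitrary: x y)
      (simp_all add: cinner_scaleR_left cinner_scaleR_right cinner_add_left cinner_add_right X_sa)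
  have "(\<lambda>n. cinner (sqrt_iter X n x) y) \<longlonglongrightarrow> cinner (sqrt_lim x) y"
    by (intro tendsto_intros sqrt_iter_tendsto)
  moreover have "(\<lambda>n. cinner (sqrt_iter X n x) y) \<longlonglongrightarrow> cinner x (sqrt_lim y)"
    unfolding sa by (intro tendsto_intros sqrt_iter_tendsto)
  ultimately show ?thesis by (rule LIMSEQ_unique)
qed

lemma sqrt_lim_fixed: "sqrt_lim x = (1/2) *\<^sub>R (X x + sqrt_lim (sqrt_lim x))"
proof (rule LIMSEQ_unique)
  show "(\<lambda>n. sqrt_iter X (Suc n) x) \<longlonglongrightarrow> sqrt_lim x"
    by (rule LIMSEQ_Suc[OF sqrt_iter_tendsto])
  \<comment> \<open>Only pointwise convergence is at hand, so Y_n Y_n x is split as Y_n (Y_n x - Y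
    x) + Y_n (Y x); the uniform contraction bound removes the first term.\<close>
  have "(\<lambda>n. sqrt_iter X n (sqrt_iter X n x - sqrt_lim x)) \<longlonglongrightarrow> 0"
  proof (rule Lim_null_comparison)
    show "\<forall>\<^sub>F n in sequentially. norm (sqrt_iter X n (sqrt_iter X n x - sqrt_lim x))
        \<le> norm (sqrt_iter X n x - sqrt_lim x)"
      by (intro always_eventually allI sqrt_iter_contraction)
    show "(\<lambda>n. norm (sqrt_iter X n x - sqrt_lim x)) \<longlonglongrightarrow> 0"
      using tendsto_norm[OF tendsto_diff[OF sqrt_iter_tendsto[of x] tendsto_const[of "sqrt_lim x"]]]
      by simp
  qed
  from tendsto_add[OF this sqrt_iter_tendsto[of "sqrt_lim x"]]
  have "(\<lambda>n. sqrt_iter X n (sqrt_iter X n x)) \<longlonglongrightarrow> sqrt_lim (sqrt_lim x)"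
    by (simp add: bounded_clinear_diff[OF bounded_clinear_sqrt_iter])
  then show "(\<lambda>n. sqrt_iter X (Suc n) x) \<longlonglongrightarrow> (1/2) *\<^sub>R (X x + sqrt_lim (sqrt_lim x))"
    unfolding sqrt_iter.simps by (intro tendsto_intros)
qed

lemma sqrt_lim_commute:
  assumes Q: "bounded_clinear Q" and QX: "\<And>x. Q (X x) = X (Q x)"
  shows "Q (sqrt_lim x) = sqrt_lim (Q x)"
proof -
  have comm: "Q (sqrt_iter X n x) = sqrt_iter X n (Q x)" for n x
    by (induction n arbitrary: x) (simp_all add: bounded_clinear_simps[OF Q] QX)
  have "(\<lambda>n. Q (sqrt_iter X n x)) \<longlonglongrightarrow> Q (sqrt_lim x)"
    using Q bounded_linear.tendsto[OF _ sqrt_iter_tendsto] unfolding bounded_clinear_def by blast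
  then show ?thesis unfolding comm using sqrt_iter_tendsto LIMSEQ_unique by blast
qed

end

text \<open>After scaling by K, X = 1 - T / K and R = sqrt K (1 - Y) for the fixed point Y; R is
  positive because Y is a contraction. The commutation clause is what the uniqueness proof
  consumes.\<close>

lemma positive_sqrt_exists:
  assumes T: "positive_op T"
  obtains R where "positive_op R" "R \<circ> R = T"
    "\<And>Q. bounded_clinear Q \<Longrightarrow> Q \<circ> T = T \<circ> Q \<Longrightarrow> Q \<circ> R = R \<circ> Q"
proof -
  obtain K where K: "0 < K" "positive_op (\<lambda>x. inverse K *\<^sub>R T x)"
    "\<And>x. norm (inverse K *\<^sub>R T x) \<le> norm x"
    using positive_op_contraction_scale[OF T] by blast
  define X where "X x = x - inverse K *\<^sub>R T x" for x
  note Kb = positive_op_bounded[OF K(2)]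
  have X: "bounded_clinear X"
    unfolding X_def by (intro bounded_clinear_sub bounded_clinear_ident Kb)
  have X_sa: "cinner (X x) y = cinner x (X y)" for x y
    by (simp add: X_def cinner_diff_left cinner_diff_right positive_op_selfadjoint[OF K(2)])
  have X_le: "norm (X x) \<le> norm x" for x
    unfolding X_def by (rule positive_contraction(2)[OF K(2,3)])
  define Y where "Y = sqrt_lim X"
  have Y: "bounded_clinear Y" and Y_le: "norm (Y x) \<le> norm x"
    and Y_sa: "cinner (Y x) y = cinner x (Y y)"
    and Y_fix: "Y x = (1/2) *\<^sub>R (X x + Y (Y x))" for x y
    unfolding Y_def using bounded_clinear_sqrt_lim sqrt_lim_le sqrt_lim_selfadjoint sqrt_lim_fixed
      X X_sa X_le by blast+
  define R where "R x = sqrt K *\<^sub>R (x - Y x)" for x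
  have R: "bounded_clinear R"
    unfolding R_def by (intro bounded_clinear_scaleR_fun bounded_clinear_sub bounded_clinear_ident Y)
  have "positive_op R"
  proof (rule selfadjoint_positive_op[OF R])
    show "cinner (R x) y = cinner x (R y)" for x y
      by (simp add: R_def cinner_scaleR_left cinner_scaleR_right cinner_diff_left cinner_diff_right Y_sa)
    show "0 \<le> R x \<bullet> x" for x
    proof -
      have "Y x \<bullet> x \<le> norm (Y x) * norm x" by (rule norm_cauchy_schwarz)
      also have "\<dots> \<le> norm x * norm x" by (intro mult_right_mono Y_le norm_ge_zero)
      finally show ?thesis
        using K(1) by (simp add: R_def inner_diff_left dot_square_norm power2_eq_square)
    qed
  qed
  moreover have "R \<circ> R = T"
  proof
    fix x
    have "R (R x) = (sqrt K * sqrt K) *\<^sub>R ((x - Y x) - Y (x - Y x))"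
      by (simp add: R_def bounded_clinear_simps[OF Y] scaleR_diff_right)
    also have "(x - Y x) - Y (x - Y x) = x - 2 *\<^sub>R Y x + Y (Y x)"
      by (simp add: bounded_clinear_simps[OF Y] scaleR_2)
    also have "2 *\<^sub>R Y x = X x + Y (Y x)" using arg_cong[OF Y_fix[of x], of "\<lambda>v. 2 *\<^sub>R v"] by simp
    finally show "(R \<circ> R) x = T x" using K(1) by (simp add: X_def)
  qed
  moreover have "Q \<circ> R = R \<circ> Q" if Q: "bounded_clinear Q" "Q \<circ> T = T \<circ> Q" for Q
  proof -
    have "Q (X x) = X (Q x)" for x
      using fun_cong[OF Q(2), of x] by (simp add: X_def bounded_clinear_simps[OF Q(1)])
    then have "Q (Y x) = Y (Q x)" for x
      unfolding Y_def using sqrt_lim_commute[OF X X_sa X_le Q(1)] by blast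
    then show ?thesis by (auto simp: R_def bounded_clinear_simps[OF Q(1)])
  qed
  ultimately show thesis by (rule that)
qed

text \<open>Q commutes with T = Q^2, hence with R, so (R + Q)(R - Q) = 0. For y = (R - Q) x both
  quadratic forms vanish at y, whence R y = Q y = 0 and |y|^2 = 0.\<close>

lemma positive_sqrt_unique:
  assumes R: "positive_op R" "R \<circ> R = T"
    and comm: "\<And>Q. bounded_clinear Q \<Longrightarrow> Q \<circ> T = T \<circ> Q \<Longrightarrow> Q \<circ> R = R \<circ> Q"
    and Q: "positive_op Q" "Q \<circ> Q = T"
  shows "Q = R"
proof
  fix x
  note Rb = positive_op_bounded[OF R(1)] and Qb = positive_op_bounded[OF Q(1)]
  have "Q \<circ> R = R \<circ> Q" by (rule comm[OF Qb]) (simp add: Q(2)[symmetric] comp_assoc)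
  then have QR: "Q (R z) = R (Q z)" for z by (metis comp_apply)
  have sq: "R (R z) = Q (Q z)" for z using R(2) Q(2) by (metis comp_apply)
  define y where "y = R x - Q x"
  have "R y + Q y = 0"
    by (simp add: y_def bounded_clinear_diff[OF Rb] bounded_clinear_diff[OF Qb] sq QR)
  then have "R y \<bullet> y + Q y \<bullet> y = 0" by (metis inner_add_left inner_zero_left)
  then have "R y \<bullet> y = 0" "Q y \<bullet> y = 0"
    using positive_op_inner[OF R(1), of y] positive_op_inner[OF Q(1), of y] by linarith+
  then have zero: "R y = 0" "Q y = 0"
    using positive_op_inner_eq_0 R(1) Q(1) by blast+
  have "cinner y y = cinner x (R y) - cinner x (Q y)"
    by (simp add: y_def cinner_diff_left cinner_diff_right bounded_clinear_diff[OF Rb]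
        bounded_clinear_diff[OF Qb] positive_op_selfadjoint[OF R(1), symmetric]
        positive_op_selfadjoint[OF Q(1), symmetric])
  then have "y = 0" using zero by (simp add: cinner_self_eq_0_iff)
  then show "Q x = R x" by (simp add: y_def)
qed

text \<open>Commutation is known only for the constructed root \<open>R'\<close>, so every candidate
  is compared with \<open>R'\<close>.\<close>

lemma op_sqrt_eqI:
  assumes R: "positive_op R" "R \<circ> R = T"
  shows "op_sqrt T = R"
proof -
  have Rb: "bounded_clinear R" by (rule positive_op_bounded[OF R(1)])
  have T: "positive_op T"
  proof (rule selfadjoint_positive_op)
    show "bounded_clinear T" unfolding R(2)[symmetric] by (rule bounded_clinear_compose[OF Rb Rb])
    show "cinner (T x) y = cinner x (T y)" for x y
      unfolding R(2)[symmetric] by (simp add: positive_op_selfadjoint[OF R(1)])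
    show "0 \<le> T x \<bullet> x" for x
      unfolding R(2)[symmetric] by (simp add: inner_eq_Re_cinner positive_op_selfadjoint[OF R(1)] cinner_self)
  qed
  obtain R' where R': "positive_op R'" "R' \<circ> R' = T"
    "\<And>Q. bounded_clinear Q \<Longrightarrow> Q \<circ> T = T \<circ> Q \<Longrightarrow> Q \<circ> R' = R' \<circ> Q"
    by (rule positive_sqrt_exists[OF T]) (rule that)
  have uniq: "Q = R'" if "positive_op Q" "Q \<circ> Q = T" for Q
    by (rule positive_sqrt_unique[OF R' that])
  show ?thesis unfolding op_sqrt_def using R uniq by (intro the_equality) blast+
qed

lemma
  assumes T: "positive_op T"
  shows positive_op_sqrt: "positive_op (op_sqrt T)" and op_sqrt_square: "op_sqrt T \<circ> op_sqrt T = T"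
proof -
  obtain R where R: "positive_op R" "R \<circ> R = T" using positive_sqrt_exists[OF T] by blast
  have "op_sqrt T = R" by (rule op_sqrt_eqI[OF R])
  then show "positive_op (op_sqrt T)" "op_sqrt T \<circ> op_sqrt T = T" using R by simp_all
qed

subsection \<open>Modulus and polar decomposition\<close>

lemma cadjoint_positive: "positive_op T \<Longrightarrow> cadjoint T = T"
  by (rule cadjoint_eqI) (rule positive_op_selfadjoint)

lemma positive_op_conjugate:
  assumes T: "positive_op T" and u: "bounded_clinear u"
  shows "positive_op (cadjoint u \<circ> T \<circ> u)"
proof (rule selfadjoint_positive_op)
  show "bounded_clinear (cadjoint u \<circ> T \<circ> u)"
    by (intro bounded_clinear_compose bounded_clinear_cadjoint u positive_op_bounded[OF T])
  show "cinner ((cadjoint u \<circ> T \<circ> u) x) y = cinner x ((cadjoint u \<circ> T \<circ> u) y)" for x y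
    by (simp add: cinner_cadjoint'[OF u, symmetric] cinner_cadjoint[OF u, symmetric]
        positive_op_selfadjoint[OF T])
  show "0 \<le> (cadjoint u \<circ> T \<circ> u) x \<bullet> x" for x
    using positive_op_inner[OF T, of "u x"]
    by (simp add: inner_eq_Re_cinner cinner_cadjoint'[OF u, symmetric])
qed

lemma positive_cadjoint_compose:
  assumes T: "bounded_clinear T"
  shows "positive_op (cadjoint T \<circ> T)"
proof -
  have "positive_op (\<lambda>x::'b. x)"
    by (rule selfadjoint_positive_op) (simp_all add: bounded_clinear_ident)
  from positive_op_conjugate[OF this T] show ?thesis by (simp add: comp_def)
qed

lemma
  assumes T: "bounded_clinear T"
  shows positive_op_abs: "positive_op (op_abs T)"
    and op_abs_square: "op_abs T \<circ> op_abs T = cadjoint T \<circ> T"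
  unfolding op_abs_def
  by (simp_all add: positive_op_sqrt op_sqrt_square positive_cadjoint_compose[OF T])

lemma norm_op_abs:
  assumes T: "bounded_clinear T"
  shows "norm (op_abs T x) = norm (T x)"
proof -
  have "cinner (op_abs T x) (op_abs T x) = cinner ((op_abs T \<circ> op_abs T) x) x"
    by (simp add: positive_op_selfadjoint[OF positive_op_abs[OF T]])
  also have "\<dots> = cinner (T x) (T x)"
    by (simp add: op_abs_square[OF T] cinner_cadjoint'[OF T, symmetric])
  finally have "(norm (op_abs T x))\<^sup>2 = (norm (T x))\<^sup>2" unfolding cinner_self of_real_eq_iff .
  then show ?thesis by simp
qed

text \<open>The equality case of Cauchy-Schwarz: \<open>u (cadjoint u v)\<close> has norm at most
  |v|, while its inner product with v is already |v|^2.\<close>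

lemma contraction_cadjoint_isometric:
  assumes u: "bounded_clinear u" and le: "\<And>x. norm (u x) \<le> norm x"
    and iso: "norm (cadjoint u v) = norm v"
  shows "u (cadjoint u v) = v"
proof -
  have "u (cadjoint u v) \<bullet> v = (norm v)\<^sup>2"
    by (simp add: inner_cadjoint[OF u] dot_square_norm iso)
  then have "(norm (u (cadjoint u v) - v))\<^sup>2 = (norm (u (cadjoint u v)))\<^sup>2 - (norm v)\<^sup>2"
    using dot_norm_neg[of "u (cadjoint u v)" v] by simp
  also have "\<dots> \<le> 0"
    using power_mono[OF le[of "cadjoint u v"] norm_ge_zero, of 2] by (simp add: iso)
  finally show ?thesis by simp
qed

section \<open>Existence and uniqueness of the polar decomposition\<close>

lemma partial_isometry_le:
  assumes u: "partial_isometry u"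
  shows "norm (u x) \<le> norm x"
proof -
  have ub: "bounded_clinear u" using u by (simp add: partial_isometry_def)
  note N = csubspace_nullspace[OF ub] closed_nullspace[OF ub]
  define p where "p = proj (nullspace u) x"
  have p: "p \<in> nullspace u" "x - p \<in> orth (nullspace u)"
    unfolding p_def using proj[OF N] by blast+
  have "u x = u (x - p)" using p(1) by (simp add: bounded_clinear_diff[OF ub] nullspace_def)
  also have "norm \<dots> = norm (x - p)" using u p(2) by (simp add: partial_isometry_def)
  also have "x - p = proj (orth (nullspace u)) x" by (simp add: proj_orth_compl[OF N] p_def)
  also have "norm \<dots> \<le> norm x"
  proof -
    have "cinner (x - p) p = 0" using p orthD(1) by blast
    then have "(x - p) \<bullet> p = 0" by (simp add: inner_eq_Re_cinner)
    then have "(norm x)\<^sup>2 = (norm (x - p))\<^sup>2 + (norm p)\<^sup>2"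
      using dot_norm[of "x - p" p] by simp
    then have "(norm (x - p))\<^sup>2 \<le> (norm x)\<^sup>2" by simp
    then have "norm (x - p) \<le> norm x" by (rule power2_le_imp_le) simp
    then show ?thesis by (simp add: proj_orth_compl[OF N] p_def)
  qed
  finally show ?thesis .
qed

text \<open>Since \<open>cadjoint e\<close> and |\<open>cadjoint e\<close>| give vectors of equal
  norm, \<open>cadjoint u\<close> is isometric on the range of |\<open>cadjoint e\<close>|. It is
  stated for contractions \<open>u\<close>, so that it also applies before \<open>u\<close> is known
  to be a partial isometry.\<close>

lemma polar_adjoint:
  assumes e: "bounded_clinear e" and u: "bounded_clinear u" and le: "\<And>x. norm (u x) \<le> norm x"
    and eq: "e = op_abs (cadjoint e) \<circ> u"
  shows "cadjoint e k = cadjoint u (op_abs (cadjoint e) k)"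
    and "u (cadjoint e k) = op_abs (cadjoint e) k"
proof -
  define D where "D = op_abs (cadjoint e)"
  have D: "positive_op D" unfolding D_def by (intro positive_op_abs bounded_clinear_cadjoint e)
  have "cadjoint e = cadjoint (D \<circ> u)" using eq by (simp add: D_def)
  also have "\<dots> = cadjoint u \<circ> D"
    by (simp add: cadjoint_compose[OF positive_op_bounded[OF D] u] cadjoint_positive[OF D])
  finally have e': "cadjoint e k = cadjoint u (D k)" for k by simp
  have "norm (cadjoint u (D k)) = norm (D k)"
    using norm_op_abs[OF bounded_clinear_cadjoint[OF e], of k] e' by (simp add: D_def)
  then have "u (cadjoint u (D k)) = D k" by (rule contraction_cadjoint_isometric[OF u le])
  then show "cadjoint e k = cadjoint u (op_abs (cadjoint e) k)"
    "u (cadjoint e k) = op_abs (cadjoint e) k"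
    using e' by (simp_all add: D_def)
qed

text \<open>\<open>u\<close> is the Douglas factor of \<open>e\<close> through
  |\<open>cadjoint e\<close>| with constant 1. It is isometric on the range of
  \<open>cadjoint e\<close>, hence on the closure, which is the complement of its nullspace.\<close>

lemma polar_exists:
  fixes e :: "'a::complex_hilbert \<Rightarrow> 'b::complex_hilbert"
  assumes e: "bounded_clinear e"
  shows "\<exists>u. partial_isometry u \<and> nullspace u = nullspace e \<and> e = op_abs (cadjoint e) \<circ> u"
proof -
  define D where "D = op_abs (cadjoint e)"
  have D: "positive_op D" unfolding D_def by (intro positive_op_abs bounded_clinear_cadjoint e)
  note Db = positive_op_bounded[OF D]
  have "norm (cadjoint e k) \<le> 1 * norm (cadjoint D k)" for k
    unfolding cadjoint_positive[OF D] unfolding D_def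
    by (simp add: norm_op_abs[OF bounded_clinear_cadjoint[OF e]])
  then obtain u where u: "bounded_clinear u" "e = D \<circ> u" "\<And>x. u x \<in> orth (nullspace D)"
    "\<And>x. norm (u x) \<le> 1 * norm x"
    using douglas_majorization[OF e Db zero_le_one] by metis
  have le: "norm (u x) \<le> norm x" for x using u(4)[of x] by simp
  have eD: "e x = D (u x)" for x using u(2) by simp
  have null: "nullspace u = nullspace e"
  proof
    show "nullspace u \<subseteq> nullspace e" by (auto simp: nullspace_def eD bounded_clinear_zero[OF Db])
    show "nullspace e \<subseteq> nullspace u"
      using orth_Int[OF _ u(3)] by (auto simp: nullspace_def eD)
  qed
  have "norm (u (cadjoint e k)) = norm (cadjoint e k)" for k
    using polar_adjoint(2)[OF e u(1) le u(2)[unfolded D_def], of k]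
      norm_op_abs[OF bounded_clinear_cadjoint[OF e], of k] by simp
  then have "range (cadjoint e) \<subseteq> {x. norm (u x) = norm x}" by blast
  moreover have "closed {x. norm (u x) = norm x}"
    by (intro closed_Collect_eq continuous_intros bounded_clinear_continuous u(1))
  ultimately have "orth (nullspace u) \<subseteq> {x. norm (u x) = norm x}"
    unfolding null orth_nullspace[OF e] by (rule closure_minimal)
  then have "partial_isometry u" using u(1) by (auto simp: partial_isometry_def)
  then show ?thesis using null u(2)[unfolded D_def] by blast
qed

text \<open>On the range of \<open>cadjoint e\<close> the value of \<open>u\<close> is dictated by
  \<open>polar_adjoint\<close>; density and the common nullspace settle the rest.\<close>

lemma polar_unique:
  assumes e: "bounded_clinear e"
    and u: "partial_isometry u" "nullspace u = nullspace e" "e = op_abs (cadjoint e) \<circ> u"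
    and v: "partial_isometry v" "nullspace v = nullspace e" "e = op_abs (cadjoint e) \<circ> v"
  shows "u = v"
proof
  fix x
  have ub: "bounded_clinear u" and vb: "bounded_clinear v"
    using u v by (simp_all add: partial_isometry_def)
  note N = csubspace_nullspace[OF e] closed_nullspace[OF e]
  define p where "p = proj (nullspace e) x"
  have p: "p \<in> nullspace e" "x - p \<in> orth (nullspace e)"
    unfolding p_def using proj[OF N] by blast+
  have "range (cadjoint e) \<subseteq> {x. u x = v x}"
    using polar_adjoint(2)[OF e ub partial_isometry_le[OF u(1)] u(3)]
      polar_adjoint(2)[OF e vb partial_isometry_le[OF v(1)] v(3)] by auto
  moreover have "closed {x. u x = v x}"
    by (intro closed_Collect_eq bounded_clinear_continuous ub vb)
  ultimately have "orth (nullspace e) \<subseteq> {x. u x = v x}"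
    unfolding orth_nullspace[OF e] by (rule closure_minimal)
  then have "u (x - p) = v (x - p)" using p(2) by blast
  moreover have "u p = 0" "v p = 0" using p(1) u(2) v(2) by (auto simp: nullspace_def)
  ultimately show "u x = v x"
    by (simp add: bounded_clinear_diff[OF ub] bounded_clinear_diff[OF vb])
qed

lemma polar_factor:
  assumes e: "bounded_clinear e"
  shows "partial_isometry (polar_factor e)" and "e = op_abs (cadjoint e) \<circ> polar_factor e"
proof -
  have "\<exists>!u. partial_isometry u \<and> nullspace u = nullspace e \<and> e = op_abs (cadjoint e) \<circ> u"
    using polar_exists[OF e] polar_unique[OF e] by blast
  from theI'[OF this] show "partial_isometry (polar_factor e)"
    "e = op_abs (cadjoint e) \<circ> polar_factor e"
    unfolding polar_factor_def by blast+
qed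

text \<open>For y in the range of T, the residual y - T x' lies both in the range and in its
  complement, so it vanishes and x' is an exact solution.\<close>

lemma mp_inverse_eqI:
  assumes T: "bounded_clinear T" and x: "x \<in> orth (nullspace T)" and y: "T x = y"
  shows "mp_inverse T y = x"
  unfolding mp_inverse_def
proof (rule the_equality)
  show "x \<in> orth (nullspace T) \<and> y - T x \<in> orth (range T)" using x y by (simp add: orth_def)
  fix x' assume x': "x' \<in> orth (nullspace T) \<and> y - T x' \<in> orth (range T)"
  have "y - T x' = T (x - x')" using y by (simp add: bounded_clinear_diff[OF T])
  then have "y - T x' = 0" using x' orth_Int by (metis rangeI)
  then show "x' = x" using x' x y by (intro nullspace_orth_inj[OF T]) auto
qed

text \<open>
  Everything about \<open>|e|\<close> is expressed through \<open>R = |e\<^sup>*|\<^sup>1\<^sup>/\<^sup>2\<close> and the polar factor \<open>u\<close>, using that \<open>u u\<^sup>*\<close>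
  fixes the range of \<open>R\<close>.
\<close>

lemma polar_sqrt:
  assumes e: "bounded_clinear e"
  defines "u \<equiv> polar_factor e" and "R \<equiv> op_sqrt (op_abs (cadjoint e))"
  shows "bounded_clinear u" and "positive_op R" and "u (cadjoint u (R x)) = R x"
    and "R (u (cadjoint u x)) = R x"
    and "e = R \<circ> R \<circ> u" and "cadjoint e = cadjoint u \<circ> R \<circ> R"
    and "op_sqrt (op_abs e) = cadjoint u \<circ> R \<circ> u"
proof -
  define D where "D = op_abs (cadjoint e)"
  have D: "positive_op D" unfolding D_def by (intro positive_op_abs bounded_clinear_cadjoint e)
  have R_D: "R = op_sqrt D" by (simp add: R_def D_def)
  have R: "positive_op R" and RR: "R \<circ> R = D"
    unfolding R_D using positive_op_sqrt[OF D] op_sqrt_square[OF D] .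
  have pu: "partial_isometry u" and eD: "e = D \<circ> u"
    unfolding u_def D_def using polar_factor[OF e] .
  have u: "bounded_clinear u" using pu by (simp add: partial_isometry_def)
  note u' = bounded_clinear_cadjoint[OF u]
  note adj = polar_adjoint[OF e u partial_isometry_le[OF pu] eD[unfolded D_def], folded D_def]
  have "range D \<subseteq> {v. u (cadjoint u v) = v}" using adj by auto
  moreover have "closed {v. u (cadjoint u v) = v}"
    using bounded_clinear_continuous[OF bounded_clinear_compose[OF u u']]
    by (intro closed_Collect_eq continuous_intros) (simp add: comp_def)
  ultimately have fix_closure: "closure (range D) \<subseteq> {v. u (cadjoint u v) = v}"
    by (rule closure_minimal)
  \<comment> \<open>R and D = R^2 have the same nullspace, so R x lies in the closure of the range
    of D, where \<open>u \<circ> cadjoint u\<close> is the identity.\<close>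
  have fixR: "u (cadjoint u (R x)) = R x" for x
  proof -
    have "cinner (R x) n = 0" if "n \<in> nullspace D" for n
    proof -
      have "R (R n) = 0" using that fun_cong[OF RR, of n] by (simp add: nullspace_def)
      then have "cinner (R n) (R n) = 0" by (simp add: positive_op_selfadjoint[OF R])
      then have "R n = 0" by (simp only: cinner_self_eq_0_iff)
      then show ?thesis by (simp add: positive_op_selfadjoint[OF R])
    qed
    then have "R x \<in> orth (nullspace D)" by (simp add: orth_def)
    then have "R x \<in> closure (range D)"
      by (simp add: orth_nullspace[OF positive_op_bounded[OF D]] cadjoint_positive[OF D])
    then show ?thesis using fix_closure by blast
  qed
  have Rfix: "R (u (cadjoint u x)) = R x" for x
  proof (rule cinner_eqI)
    fix z
    have "cinner (R (u (cadjoint u x))) z = cinner x (u (cadjoint u (R z)))"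
      by (simp only: positive_op_selfadjoint[OF R] cinner_cadjoint[OF u]
          cinner_cadjoint'[OF u, of x "cadjoint u (R z)"])
    also have "\<dots> = cinner (R x) z" by (simp add: fixR positive_op_selfadjoint[OF R])
    finally show "cinner (R (u (cadjoint u x))) z = cinner (R x) z" .
  qed
  have RR': "R (R x) = D x" for x using fun_cong[OF RR, of x] by simp
  have e1: "e = R \<circ> R \<circ> u" unfolding RR by (rule eD)
  have e2: "cadjoint e = cadjoint u \<circ> R \<circ> R" by (rule ext) (simp add: RR' adj(1))
  \<comment> \<open>Squaring the right side, the inner product of factors
    \<open>u \<circ> cadjoint u\<close> is absorbed by D and leaves
    \<open>cadjoint u \<circ> D \<circ> D \<circ> u\<close>, that is,
    \<open>cadjoint e \<circ> e\<close>.\<close>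
  have "op_abs e = cadjoint u \<circ> D \<circ> u"
    unfolding op_abs_def
  proof (rule op_sqrt_eqI[OF positive_op_conjugate[OF D u]])
    show "cadjoint u \<circ> D \<circ> u \<circ> (cadjoint u \<circ> D \<circ> u) = cadjoint e \<circ> e"
      by (simp add: e2 RR[symmetric] fun_eq_iff fixR) (simp add: e1)
  qed
  moreover have "op_sqrt (cadjoint u \<circ> D \<circ> u) = cadjoint u \<circ> R \<circ> u"
    by (rule op_sqrt_eqI[OF positive_op_conjugate[OF R u]])
      (simp add: RR[symmetric] fun_eq_iff fixR)
  ultimately show "op_sqrt (op_abs e) = cadjoint u \<circ> R \<circ> u" by simp
  show "bounded_clinear u" "positive_op R" "u (cadjoint u (R x)) = R x"
    "R (u (cadjoint u x)) = R x" "e = R \<circ> R \<circ> u" "cadjoint e = cadjoint u \<circ> R \<circ> R"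
    by (fact u R fixR Rfix e1 e2)+
qed

text \<open>This makes complementability imply weak complementability, so the shorted operator is
  given by its formula and not by \<open>undefined\<close>.\<close>

lemma range_op_sqrt_abs:
  assumes e: "bounded_clinear e"
  shows "range (cadjoint e) \<subseteq> range (op_sqrt (op_abs e))"
    and "range e \<subseteq> range (op_sqrt (op_abs (cadjoint e)))"
proof -
  define u where "u = polar_factor e"
  define R where "R = op_sqrt (op_abs (cadjoint e))"
  note p = polar_sqrt[OF e, folded u_def R_def]
  have "cadjoint e k = op_sqrt (op_abs e) (cadjoint u (R k))" for k
    unfolding p(6,7) by (simp add: p(3))
  then show "range (cadjoint e) \<subseteq> range (op_sqrt (op_abs e))" by (metis image_subsetI rangeI)
  have "e x = R (R (u x))" for x using fun_cong[OF p(5), of x] by (simp only: comp_apply)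
  then have "range e \<subseteq> range R" by (metis image_subsetI rangeI)
  then show "range e \<subseteq> range (op_sqrt (op_abs (cadjoint e)))" by (simp only: R_def)
qed

text \<open>
  The correction term \<open>g\<^sup>* f\<close> of the bilateral shorted operator: with \<open>F = |e|\<^sup>1\<^sup>/\<^sup>2 = u\<^sup>* R u\<close> one has
  \<open>f = F w\<close>, \<open>g = F u\<^sup>* z\<close>.
\<close>

lemma shorted_correction:
  assumes e: "bounded_clinear e" and c: "bounded_clinear c"
    and w: "d = e \<circ> w" and z: "bounded_clinear z" "cadjoint c = cadjoint e \<circ> z"
  shows "cadjoint (mp_inverse (op_sqrt (op_abs e)) \<circ> cadjoint c)
      ((mp_inverse (op_sqrt (op_abs (cadjoint e)) \<circ> polar_factor e) \<circ> d) x) = c (w x)"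
proof -
  define u where "u = polar_factor e"
  define R where "R = op_sqrt (op_abs (cadjoint e))"
  define F where "F = cadjoint u \<circ> R \<circ> u"
  note p = polar_sqrt[OF e, folded u_def R_def]
  note u = p(1) and R = p(2)
  note Rb = positive_op_bounded[OF R] and u' = bounded_clinear_cadjoint[OF u]
  have F: "positive_op F" unfolding F_def by (rule positive_op_conjugate[OF R u])
  note Fb = positive_op_bounded[OF F]
  have F_orth: "F v \<in> orth (nullspace F)" for v
    by (simp add: orth_def nullspace_def positive_op_selfadjoint[OF F])
  have eR: "e v = R (R (u v))" for v using fun_cong[OF p(5), of v] by simp
  have e'R: "cadjoint e v = cadjoint u (R (R v))" for v using fun_cong[OF p(6), of v] by simp
  have f: "mp_inverse (R \<circ> u) (d v) = F (w v)" for v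
  proof (rule mp_inverse_eqI)
    show "bounded_clinear (R \<circ> u)" by (rule bounded_clinear_compose[OF Rb u])
    \<comment> \<open>F is \<open>cadjoint u\<close> applied after R u, so it vanishes where R u
      does; values of F are therefore orthogonal to the nullspace of R u.\<close>
    have "nullspace (R \<circ> u) \<subseteq> nullspace F"
      by (auto simp: nullspace_def F_def bounded_clinear_zero[OF u'])
    then show "F (w v) \<in> orth (nullspace (R \<circ> u))" using F_orth[of "w v"] by (auto simp: orth_def)
    show "(R \<circ> u) (F (w v)) = d v" by (simp add: F_def p(3) w eR)
  qed
  have g: "mp_inverse F (cadjoint c v) = F (cadjoint u (z v))" for v
  proof (rule mp_inverse_eqI[OF Fb F_orth])
    show "F (F (cadjoint u (z v))) = cadjoint c v" by (simp add: F_def p(3,4) z(2) e'R)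
  qed
  \<comment> \<open>In this form the correction term collapses: \<open>cadjoint z\<close> u F F w =
    \<open>cadjoint z\<close> e w = c w.\<close>
  have c_eq: "c v = cadjoint z (e v)" for v
  proof -
    have "c = cadjoint (cadjoint e \<circ> z)" using cadjoint_cadjoint[OF c] z(2) by simp
    also have "\<dots> = cadjoint z \<circ> e"
      by (simp add: cadjoint_compose[OF bounded_clinear_cadjoint[OF e] z(1)] cadjoint_cadjoint[OF e])
    finally show ?thesis by simp
  qed
  have "cadjoint (mp_inverse F \<circ> cadjoint c) = cadjoint (F \<circ> (cadjoint u \<circ> z))"
    by (rule arg_cong[of _ _ cadjoint]) (simp add: fun_eq_iff g)
  also have "\<dots> = cadjoint z \<circ> u \<circ> F"
    by (simp add: cadjoint_compose bounded_clinear_compose Fb u' z(1) cadjoint_positive[OF F]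
        cadjoint_cadjoint[OF u])
  finally have eq: "cadjoint (mp_inverse F \<circ> cadjoint c) (mp_inverse (R \<circ> u) (d x)) =
      cadjoint z (u (F (F (w x))))" by (simp add: f)
  have "u (F (F (w x))) = e (w x)" by (simp add: F_def p(3) eR)
  then show ?thesis
    using eq unfolding p(7)[folded F_def] R_def[symmetric] u_def[symmetric] comp_apply c_eq[of "w x"]
    by simp
qed

subsection \<open>Block decompositions\<close>

lemma ops_betweenD:
  assumes "T \<in> ops_between M N"
  shows "bounded_clinear T" "T x \<in> N" "x \<in> orth M \<Longrightarrow> T x = 0"
  using assms by (auto simp: ops_between_def)

lemma ops_between_proj:
  assumes M: "csubspace M" "closed M" and T: "T \<in> ops_between M N"
  shows "T (proj M x) = T x"
proof -
  have "T (x - proj M x) = 0" by (rule ops_betweenD(3)[OF T proj_orth[OF M]])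
  then show ?thesis by (simp add: bounded_clinear_diff[OF ops_betweenD(1)[OF T]])
qed

lemma ops_between_compose:
  assumes S: "S \<in> ops_between M N" and T: "T \<in> ops_between L M"
  shows "S \<circ> T \<in> ops_between L N"
  using ops_betweenD[OF S] ops_betweenD[OF T]
  by (auto simp: ops_between_def bounded_clinear_compose bounded_clinear_zero)

lemma cadjoint_ops_between:
  assumes M: "csubspace M" "closed M" and T: "T \<in> ops_between M N"
  shows "cadjoint T \<in> ops_between N M"
proof -
  note t = ops_betweenD[OF T]
  have "cadjoint T y \<in> orth (orth M)" for y
    by (auto simp: orth_def cinner_cadjoint'[OF t(1), symmetric] t(3)[unfolded orth_def])
  moreover have "cadjoint T y = 0" if "y \<in> orth N" for y
  proof -
    have "cinner (cadjoint T y) (cadjoint T y) = cinner y (T (cadjoint T y))"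
      by (rule cinner_cadjoint'[OF t(1), symmetric])
    also have "\<dots> = 0" using that t(2) by (rule orthD(1))
    finally show ?thesis by (simp only: cinner_self_eq_0_iff)
  qed
  ultimately show ?thesis
    by (simp add: ops_between_def bounded_clinear_cadjoint[OF t(1)] orth_orth[OF M])
qed

text \<open>The Douglas factor already maps between the right subspaces: its values avoid the
  nullspace of D, which contains \<open>orth M\<close>, and D W = C forces it to vanish where C
  does.\<close>

lemma douglas_ops_between:
  assumes M: "csubspace M" "closed M"
    and C: "C \<in> ops_between L N" and D: "D \<in> ops_between M N" and sub: "range C \<subseteq> range D"
  shows "\<exists>W \<in> ops_between L M. C = D \<circ> W"
proof -
  note c = ops_betweenD[OF C] and d = ops_betweenD[OF D]
  obtain W where W: "bounded_clinear W" "C = D \<circ> W" "\<And>x. W x \<in> orth (nullspace D)"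
    using douglas[OF c(1) d(1) sub] by metis
  have "orth M \<subseteq> nullspace D" using d(3) by (auto simp: nullspace_def)
  then have "orth (nullspace D) \<subseteq> orth (orth M)" by (auto simp: orth_def)
  then have "W x \<in> M" for x using W(3) orth_orth[OF M] by blast
  moreover have "W x = 0" if "x \<in> orth L" for x
  proof (rule orth_Int[OF _ W(3)])
    show "W x \<in> nullspace D" using c(3)[OF that] W(2) by (simp add: nullspace_def)
  qed
  ultimately have "W \<in> ops_between L M" using W(1) by (simp add: ops_between_def)
  then show ?thesis using W(2) by blast
qed

context
  fixes M :: "'a::complex_hilbert set" and N :: "'b::complex_hilbert set"
  assumes M: "csubspace M" "closed M" and N: "csubspace N" "closed N"
begin

lemma block_ops_between:
  assumes T: "bounded_clinear T"
  shows "block M N T \<in> ops_between M N"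
proof -
  have "bounded_clinear (proj N \<circ> (T \<circ> proj M))"
    by (intro bounded_clinear_compose bounded_clinear_proj M N T)
  then show ?thesis
    by (auto simp: ops_between_def block_def comp_def proj_in[OF N] proj_zero[OF M(1)]
        bounded_clinear_zero[OF T] proj_id[OF N(1)] N(1)[unfolded csubspace_def])
qed

lemma cadjoint_block:
  assumes T: "bounded_clinear T"
  shows "cadjoint (block M N T) = block N M (cadjoint T)"
proof (rule cadjoint_eqI)
  fix x y
  have "cinner (block M N T x) y = cinner (T (proj M x)) (proj N y)"
    unfolding block_def by (metis cinner_proj_proj[OF N])
  also have "\<dots> = cinner (proj M x) (cadjoint T (proj N y))" by (rule cinner_cadjoint[OF T])
  also have "\<dots> = cinner x (block N M (cadjoint T) y)"
    unfolding block_def by (metis cinner_proj_proj[OF M])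
  finally show "cinner (block M N T x) y = cinner x (block N M (cadjoint T) y)" .
qed

lemma block_sum:
  assumes T: "bounded_clinear T"
  shows "T = block_matrix (block (orth M) (orth N) T) (block M (orth N) T)
    (block (orth M) N T) (block M N T)"
  by (rule ext)
    (simp add: block_matrix_def block_def proj_orth_compl[OF M] proj_orth_compl[OF N]
      bounded_clinear_diff[OF T] bounded_clinear_diff[OF bounded_clinear_proj[OF N]])

lemma block_add:
  "block M N (\<lambda>x. S x + T x) x = block M N S x + block M N T x"
  by (simp add: block_def bounded_clinear_add[OF bounded_clinear_proj[OF N]])

lemma block_id:
  assumes "T \<in> ops_between M N" shows "block M N T x = T x"
  by (simp add: block_def ops_between_proj[OF M assms] proj_id[OF N(1) ops_betweenD(2)[OF assms]])

lemma block_eq_0_left: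
  assumes "T \<in> ops_between L N'" "M \<subseteq> orth L" shows "block M N T x = 0"
  using ops_betweenD(3)[OF assms(1)] proj_in[OF M, of x] assms(2) N(1)
  by (simp add: block_def subset_iff csubspace_def proj_id[OF N(1)])

lemma block_eq_0_right:
  assumes "T \<in> ops_between L N'" "N' \<subseteq> orth N" shows "block M N T x = 0"
  using ops_betweenD(2)[OF assms(1)] assms(2) by (simp add: block_def subset_iff proj_zero[OF N(1)])

end

text \<open>Turns condition 2 into four separate equations. Each compression kills the other three
  entries, by their domain or by their codomain.\<close>

lemma block_matrix_iff:
  fixes M :: "'a::complex_hilbert set" and N :: "'b::complex_hilbert set"
  assumes M: "csubspace M" "closed M" and N: "csubspace N" "closed N"
    and B: "bounded_clinear B"
    and t: "t11 \<in> ops_between (orth M) (orth N)" "t12 \<in> ops_between M (orth N)"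
      "t21 \<in> ops_between (orth M) N" "t22 \<in> ops_between M N"
  shows "B = block_matrix t11 t12 t21 t22 \<longleftrightarrow>
    block (orth M) (orth N) B = t11 \<and> block M (orth N) B = t12 \<and>
    block (orth M) N B = t21 \<and> block M N B = t22"
proof
  note M' = csubspace_orth[of M] closed_orth[of M] and N' = csubspace_orth[of N] closed_orth[of N]
  have sub: "M \<subseteq> orth (orth M)" "N \<subseteq> orth (orth N)" "orth M \<subseteq> orth M" "orth N \<subseteq> orth N"
    using orth_orth[OF M] orth_orth[OF N] by simp_all
  assume eq: "B = block_matrix t11 t12 t21 t22"
  show "block (orth M) (orth N) B = t11 \<and> block M (orth N) B = t12 \<and>
      block (orth M) N B = t21 \<and> block M N B = t22"
    unfolding eq block_matrix_def fun_eq_iff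
    by (simp add: block_add M N M' N' block_id t
        block_eq_0_left[OF M N t(1) sub(1)] block_eq_0_left[OF M N' t(1) sub(1)]
        block_eq_0_left[OF M N t(3) sub(1)] block_eq_0_left[OF M N' t(3) sub(1)]
        block_eq_0_left[OF M' N t(2) sub(3)] block_eq_0_left[OF M' N' t(2) sub(3)]
        block_eq_0_left[OF M' N t(4) sub(3)] block_eq_0_left[OF M' N' t(4) sub(3)]
        block_eq_0_right[OF M N t(2) sub(4)] block_eq_0_right[OF M' N t(1) sub(4)]
        block_eq_0_right[OF M N' t(4) sub(2)] block_eq_0_right[OF M' N' t(3) sub(2)])
next
  assume "block (orth M) (orth N) B = t11 \<and> block M (orth N) B = t12 \<and>
    block (orth M) N B = t21 \<and> block M N B = t22"
  then show "B = block_matrix t11 t12 t21 t22" using block_sum[OF M N B] by simp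
qed

subsection \<open>The bilateral shorted operator of a complementable operator\<close>

text \<open>Replaces the formula with \<open>f\<close> and \<open>g\<close> by the Schur complement.
  The factor \<open>z\<close> is returned as well, since it plays for \<open>cadjoint S\<close> the
  part of \<open>w\<close>.\<close>

lemma bilateral_shorted_complementable:
  fixes M :: "'a::complex_hilbert set" and N :: "'b::complex_hilbert set"
  assumes M: "csubspace M" "closed M" and N: "csubspace N" "closed N"
    and B: "bounded_clinear B" and comp: "complementable B M N"
  obtains w z where "bounded_clinear w" "bounded_clinear z"
    "block M (orth N) B = block (orth M) (orth N) B \<circ> w"
    "cadjoint (block (orth M) N B) = cadjoint (block (orth M) (orth N) B) \<circ> z"
    "bilateral_shorted B M N = (\<lambda>x. block M N B x - block (orth M) N B (w x))"
proof -
  define c where "c = block (orth M) N B"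
  define d where "d = block M (orth N) B"
  define e where "e = block (orth M) (orth N) B"
  note M' = csubspace_orth[of M] closed_orth[of M] and N' = csubspace_orth[of N] closed_orth[of N]
  have c: "bounded_clinear c" unfolding c_def by (rule ops_betweenD(1)[OF block_ops_between[OF M' N B]])
  have d: "bounded_clinear d" unfolding d_def by (rule ops_betweenD(1)[OF block_ops_between[OF M N' B]])
  have e: "bounded_clinear e" unfolding e_def by (rule ops_betweenD(1)[OF block_ops_between[OF M' N' B]])
  have sub: "range (cadjoint c) \<subseteq> range (cadjoint e)" "range d \<subseteq> range e"
    using comp by (simp_all add: complementable_def Let_def c_def d_def e_def)
  obtain w where w: "bounded_clinear w" "d = e \<circ> w" using douglas[OF d e sub(2)] by metis
  obtain z where z: "bounded_clinear z" "cadjoint c = cadjoint e \<circ> z"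
    using douglas[OF bounded_clinear_cadjoint[OF c] bounded_clinear_cadjoint[OF e] sub(1)] by metis
  have "weakly_complementable B M N"
    using sub range_op_sqrt_abs[OF e]
    unfolding weakly_complementable_def Let_def c_def d_def e_def by blast
  then have "bilateral_shorted B M N = (\<lambda>x. block M N B x - c (w x))"
    unfolding bilateral_shorted_def Let_def c_def[symmetric] d_def[symmetric] e_def[symmetric]
    by (simp only: if_True block_matrix_def shorted_correction[OF e c w(2) z] add_0_right)
  then show thesis using that w z unfolding c_def d_def e_def by blast
qed

text \<open>
  Solving \<open>B k = A h\<close> by eliminating the component of \<open>k\<close> in \<open>M\<^sup>\<bottom>\<close> leaves the equation
  \<open>S q = - c h\<close> for the component \<open>q\<close> in \<open>M\<close>.
\<close>

lemma range_subset_range_iff_shorted: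
  assumes A: "bounded_clinear A" and B: "bounded_clinear B"
    and N: "csubspace N" "closed N"
    and S: "S \<in> ops_between (nullspace A) N"
    and e: "block (orth (nullspace A)) (orth N) B = A"
    and d: "block (nullspace A) (orth N) B = A \<circ> w"
    and S_eq: "\<And>x. S x = block (nullspace A) N B x - block (orth (nullspace A)) N B (w x)"
  shows "range A \<subseteq> range B \<longleftrightarrow> range (block (orth (nullspace A)) N B) \<subseteq> range S"
proof -
  define M where "M = nullspace A"
  define c where "c = block (orth M) N B"
  have M: "csubspace M" "closed M"
    unfolding M_def using csubspace_nullspace[OF A] closed_nullspace[OF A] .
  note M' = csubspace_orth[of M] closed_orth[of M] and N' = csubspace_orth[of N] closed_orth[of N]
  have cop: "c \<in> ops_between (orth M) N" unfolding c_def by (rule block_ops_between[OF M' N B])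
  note c = bounded_clinear_simps[OF ops_betweenD(1)[OF cop]]
  have c_null: "c v = 0" if "A v = 0" for v
    using ops_betweenD(3)[OF cop] that by (simp add: orth_orth[OF M]) (simp add: M_def nullspace_def)
  have cN: "c v \<in> N" for v by (rule ops_betweenD(2)[OF cop])
  have AN: "A v \<in> orth N" for v
    using ops_betweenD(2)[OF block_ops_between[OF M' N' B], of v] by (simp add: e[folded M_def])
  have SN: "S v \<in> N" for v by (rule ops_betweenD(2)[OF S])
  have A_proj: "A (v - proj M v) = A v" for v
    using proj_in[OF M, of v] by (simp add: bounded_clinear_diff[OF A] M_def nullspace_def)
  \<comment> \<open>Elimination: b k + c k = S k + c (k + w k). The first bracket lies in
    \<open>orth N\<close> and the second in \<open>N\<close>, so equations for \<open>B k\<close>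
    split in two.\<close>
  have B_eq: "B k = (A k + A (w k)) + (c (k + w k) + S k)" for k
    using fun_cong[OF block_sum[OF M N B], of k]
    by (simp add: block_matrix_def e[folded M_def] d[folded M_def] S_eq[folded M_def]
        c_def[symmetric] c)
  show ?thesis
    unfolding M_def[symmetric] c_def[symmetric]
  proof
    assume sub: "range A \<subseteq> range B"
    show "range c \<subseteq> range S"
    proof
      fix v assume "v \<in> range c"
      then obtain h where h: "v = c h" by blast
      obtain k where k: "A h = B k" using sub by (metis imageE rangeI subsetD)
      have n: "A h - A k - A (w k) = c (k + w k) + S k" using B_eq[of k] k by (simp add: algebra_simps)
      have "A h - A k - A (w k) \<in> orth N" using AN N' csubspace_diff by metis
      moreover have "c (k + w k) + S k \<in> N" using cN SN N(1) by (simp add: csubspace_def)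
      ultimately have z: "A h - A k - A (w k) = 0" "c (k + w k) + S k = 0"
        using n orth_Int by metis+
      \<comment> \<open>\<open>c\<close> vanishes on the nullspace of \<open>A\<close>, so it takes
        equal values at \<open>h\<close> and \<open>k + w k\<close>.\<close>
      have "A (h - (k + w k)) = 0" using z(1) by (simp add: bounded_clinear_simps[OF A] algebra_simps)
      then have "c h = c (k + w k)" using c_null c(2) by (metis eq_iff_diff_eq_0)
      also have "\<dots> = S (- k)"
        using z(2) by (simp add: bounded_clinear_minus[OF ops_betweenD(1)[OF S]] eq_neg_iff_add_eq_0)
      finally show "v \<in> range S" unfolding h by (rule range_eqI)
    qed
  next
    assume sub: "range c \<subseteq> range S"
    show "range A \<subseteq> range B"
    proof
      fix v assume "v \<in> range A"
      then obtain h where h: "v = A h" by blast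
      obtain q' where q': "c h = S q'" using sub by (metis imageE rangeI subsetD)
      \<comment> \<open>The projection leaves the value under \<open>S\<close> unchanged and makes
        \<open>A q = 0\<close>; the sign lets \<open>S q\<close> cancel \<open>c h\<close>.\<close>
      define q where "q = - proj M q'"
      have qM: "q \<in> M"
        unfolding q_def using proj_in[OF M] M(1) scaleC_minus_one by (metis csubspace_def)
      have Sq: "S q = - c h"
        by (simp add: q_def bounded_clinear_minus[OF ops_betweenD(1)[OF S]]
            ops_between_proj[OF M S[folded M_def]] q')
      \<comment> \<open>Back substitution: \<open>p\<close> is the component of
        \<open>h - w q\<close> in \<open>orth M\<close>, giving A p + A (w q) = A h and c p + c (w
        q) = c h.\<close>
      define p where "p = (h - w q) - proj M (h - w q)"
      have pM: "p \<in> orth M" unfolding p_def by (rule proj_orth[OF M])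
      have dA: "A (w p) = 0"
        using ops_betweenD(3)[OF block_ops_between[OF M N' B] pM] by (simp add: d[folded M_def])
      have Aq: "A q = 0" using qM by (simp add: M_def nullspace_def)
      have Ap: "A p = A h - A (w q)"
        unfolding p_def A_proj by (rule bounded_clinear_diff[OF A])
      have "c (p - (h - w q)) = 0"
        by (rule c_null) (simp add: bounded_clinear_simps[OF A] Ap)
      then have cp: "c p = c h - c (w q)" by (simp add: c)
      have "B p = A p + c p"
        using B_eq[of p] ops_betweenD(3)[OF S[folded M_def] pM] by (simp add: dA c c_null[OF dA])
      moreover have "B q = A (w q) + (c (w q) + S q)"
        using B_eq[of q] by (simp add: Aq c c_null[OF Aq])
      ultimately have "B (p + q) = A h"
        by (simp add: bounded_clinear_add[OF B] Ap cp Sq)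
      then show "v \<in> range B" unfolding h by (metis rangeI)
    qed
  qed
qed

text \<open>Moving operators across the inner product, the identity says that (B - A)
  \<open>cadjoint A\<close> y is orthogonal to the range of A for all y, hence lies in
  \<open>N\<close>. By density and closedness of \<open>N\<close> this extends to
  \<open>orth M\<close>, where it says that compressing \<open>B\<close> to \<open>orth N\<close>
  gives \<open>A\<close>.\<close>

lemma diamond_middle_iff:
  fixes A B :: "'a::complex_hilbert \<Rightarrow> 'b::complex_hilbert"
  assumes A: "bounded_clinear A" and B: "bounded_clinear B"
  shows "A \<circ> cadjoint A \<circ> A = A \<circ> cadjoint B \<circ> A \<longleftrightarrow>
    block (orth (nullspace A)) (orth (nullspace (cadjoint A))) B = A"
proof -
  define M where "M = nullspace A"
  define N where "N = nullspace (cadjoint A)"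
  note A' = bounded_clinear_cadjoint[OF A]
  have M: "csubspace M" "closed M"
    unfolding M_def using csubspace_nullspace[OF A] closed_nullspace[OF A] .
  have N: "csubspace N" "closed N"
    unfolding N_def using csubspace_nullspace[OF A'] closed_nullspace[OF A'] .
  have A_proj: "A (v - proj M v) = A v" for v
    using proj_in[OF M, of v] by (simp add: bounded_clinear_diff[OF A] M_def nullspace_def)
  have AN: "A v \<in> orth N" for v
    using closure_subset[of "range A"] orth_nullspace[OF A'] by (auto simp: N_def cadjoint_cadjoint[OF A])
  have D: "bounded_clinear (\<lambda>v. B v - A v)" by (rule bounded_clinear_sub[OF B A])
  have move: "cinner (A (cadjoint A (A x))) y = cinner (A x) (A (cadjoint A y))"
    "cinner (A (cadjoint B (A x))) y = cinner (A x) (B (cadjoint A y))" for x y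
    by (simp_all only: cinner_cadjoint[OF A, of "cadjoint A (A x)"] cinner_cadjoint[OF A, of "cadjoint B (A x)"]
        cinner_cadjoint'[OF A, of "A x" "cadjoint A y"] cinner_cadjoint'[OF B, of "A x" "cadjoint A y"])
  have "A \<circ> cadjoint A \<circ> A = A \<circ> cadjoint B \<circ> A \<longleftrightarrow>
      (\<forall>x y. cinner (A (cadjoint A (A x))) y = cinner (A (cadjoint B (A x))) y)"
    by (auto simp: fun_eq_iff intro!: cinner_eqI[where 'a = 'b])
  also have "\<dots> \<longleftrightarrow> (\<forall>x y. cinner (A x) (B (cadjoint A y) - A (cadjoint A y)) = 0)"
    by (simp only: move cinner_diff_right right_minus_eq eq_commute[of "cinner (A _) (A _)"])
  also have "\<dots> \<longleftrightarrow> (\<forall>y. B (cadjoint A y) - A (cadjoint A y) \<in> N)"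
    unfolding N_def orth_range[OF A, symmetric]
    by (auto simp: orth_def cinner_eq_0_commute[of "A _"])
  also have "\<dots> \<longleftrightarrow> (\<forall>v\<in>orth M. B v - A v \<in> N)"
  proof
    assume "\<forall>y. B (cadjoint A y) - A (cadjoint A y) \<in> N"
    then have "range (cadjoint A) \<subseteq> (\<lambda>v. B v - A v) -` N" by auto
    moreover have "closed ((\<lambda>v. B v - A v) -` N)"
      using N(2) bounded_clinear_continuous[OF D] by (rule closed_vimage)
    ultimately have "orth M \<subseteq> (\<lambda>v. B v - A v) -` N"
      unfolding M_def orth_nullspace[OF A] by (rule closure_minimal)
    then show "\<forall>v\<in>orth M. B v - A v \<in> N" by auto
  next
    assume "\<forall>v\<in>orth M. B v - A v \<in> N"
    then show "\<forall>y. B (cadjoint A y) - A (cadjoint A y) \<in> N"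
      using closure_subset[of "range (cadjoint A)"] unfolding M_def orth_nullspace[OF A] by auto
  qed
  also have "\<dots> \<longleftrightarrow> block (orth M) (orth N) B = A"
  proof
    assume *: "\<forall>v\<in>orth M. B v - A v \<in> N"
    have "block (orth M) (orth N) B x = A x" for x
    proof -
      define v where "v = x - proj M x"
      have "B v - A v \<in> N" using * proj_orth[OF M] by (simp add: v_def)
      then have "B v - A v \<in> orth (orth N)" by (simp add: orth_orth[OF N])
      then have "proj (orth N) (B v) = A v" by (rule proj_eqI[OF csubspace_orth AN])
      then show ?thesis by (simp add: block_def proj_orth_compl[OF M] v_def A_proj)
    qed
    then show "block (orth M) (orth N) B = A" by blast
  next
    assume *: "block (orth M) (orth N) B = A"
    show "\<forall>v\<in>orth M. B v - A v \<in> N"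
    proof
      fix v assume "v \<in> orth M"
      then have "A v = proj (orth N) (B v)"
        using fun_cong[OF *, of v] by (simp add: block_def proj_id[OF csubspace_orth])
      then show "B v - A v \<in> N" using proj_in[OF N] by (simp add: proj_orth_compl[OF N])
    qed
  qed
  finally show ?thesis unfolding M_def N_def .
qed

theorem proposition3p5:
  fixes A B S a b22 :: "'h::complex_hilbert \<Rightarrow> 'k::complex_hilbert"
  assumes "bounded_clinear A" and "bounded_clinear B"
    and "complementable B (nullspace A) (nullspace (cadjoint A))"
    and "S = bilateral_shorted B (nullspace A) (nullspace (cadjoint A))"
    and "a = block (closure (range (cadjoint A))) (closure (range A)) A"
    and "b22 = block (nullspace A) (nullspace (cadjoint A)) B"
  shows "diamond_le A B \<longleftrightarrow>
    (\<exists>y \<in> ops_between (closure (range (cadjoint A))) (nullspace A).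
     \<exists>x \<in> ops_between (nullspace (cadjoint A)) (closure (range A)).
       B = block_matrix a (x \<circ> S) (S \<circ> y) b22)"
proof -
  note A = assms(1) and B = assms(2)
  note A' = bounded_clinear_cadjoint[OF A] and B' = bounded_clinear_cadjoint[OF B]
  define M where "M = nullspace A"
  define N where "N = nullspace (cadjoint A)"
  have M: "csubspace M" "closed M"
    unfolding M_def using csubspace_nullspace[OF A] closed_nullspace[OF A] .
  have N: "csubspace N" "closed N"
    unfolding N_def using csubspace_nullspace[OF A'] closed_nullspace[OF A'] .
  note M' = csubspace_orth[of M] closed_orth[of M] and N' = csubspace_orth[of N] closed_orth[of N]
  have cl: "closure (range (cadjoint A)) = orth M" "closure (range A) = orth N"
    unfolding M_def N_def
    using orth_nullspace[OF A] orth_nullspace[OF A'] cadjoint_cadjoint[OF A] by simp_all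
  define c where "c = block (orth M) N B"
  define d where "d = block M (orth N) B"
  define e where "e = block (orth M) (orth N) B"
  have c: "c \<in> ops_between (orth M) N" unfolding c_def by (rule block_ops_between[OF M' N B])
  have d: "d \<in> ops_between M (orth N)" unfolding d_def by (rule block_ops_between[OF M N' B])
  have e: "e \<in> ops_between (orth M) (orth N)" unfolding e_def by (rule block_ops_between[OF M' N' B])
  have b22: "b22 \<in> ops_between M N"
    using block_ops_between[OF M N B] by (simp add: assms(6) M_def N_def)
  have b22_eq: "b22 = block M N B" and S_def: "S = bilateral_shorted B M N"
    by (simp_all add: assms(4,6) M_def N_def)
  obtain w z where wz: "bounded_clinear w" "bounded_clinear z" "d = e \<circ> w"
    "cadjoint c = cadjoint e \<circ> z" "S = (\<lambda>x. b22 x - c (w x))"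
    by (rule bilateral_shorted_complementable[OF M N B assms(3)[folded M_def N_def],
          folded c_def d_def e_def b22_eq S_def]) (rule that)
  note w = wz(1,3) and z = wz(2,4) and S_eq = wz(5)
  note cb = ops_betweenD(1)[OF c] and db = ops_betweenD(1)[OF d] and eb = ops_betweenD(1)[OF e]
  have c_ze: "c v = cadjoint z (e v)" for v
  proof -
    have "c = cadjoint (cadjoint e \<circ> z)" using cadjoint_cadjoint[OF cb] z(2) by simp
    also have "\<dots> = cadjoint z \<circ> e"
      by (simp add: cadjoint_compose[OF bounded_clinear_cadjoint[OF eb] z(1)] cadjoint_cadjoint[OF eb])
    finally show ?thesis by simp
  qed
  have S: "S \<in> ops_between M N"
  proof -
    have "bounded_clinear S"
      using bounded_clinear_sub[OF ops_betweenD(1)[OF b22] bounded_clinear_compose[OF cb w(1)]]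
      by (simp add: S_eq comp_def)
    moreover have "S v \<in> N" for v
      unfolding S_eq by (intro csubspace_diff N ops_betweenD(2)[OF b22] ops_betweenD(2)[OF c])
    \<comment> \<open>\<open>w v\<close> itself may be nonzero here, but c (w v) =
      \<open>cadjoint z\<close> (d v) and \<open>d\<close> vanishes on
      \<open>orth M\<close>.\<close>
    moreover have "S v = 0" if "v \<in> orth M" for v
      using ops_betweenD(3)[OF b22 that] ops_betweenD(3)[OF d that] w(2)
      by (simp add: S_eq c_ze bounded_clinear_zero[OF bounded_clinear_cadjoint[OF z(1)]])
    ultimately show ?thesis by (simp add: ops_between_def)
  qed
  \<comment> \<open>The adjoint of c w is \<open>cadjoint w\<close> \<open>cadjoint e\<close> z,
    which is \<open>cadjoint d\<close> z: the Schur complement formula for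
    \<open>cadjoint B\<close>.\<close>
  have cadj_S: "cadjoint S v = cadjoint b22 v - cadjoint d (z v)" for v
  proof -
    have "cadjoint S = (\<lambda>v. cadjoint b22 v - cadjoint (c \<circ> w) v)"
      using cadjoint_sub[OF ops_betweenD(1)[OF b22] bounded_clinear_compose[OF cb w(1)]]
      by (simp add: S_eq)
    then show ?thesis
      by (simp add: cadjoint_compose[OF cb w(1)] z(2) w(2) cadjoint_compose[OF eb w(1)])
  qed
  have A_op: "A \<in> ops_between (orth M) (orth N)"
    unfolding ops_between_def orth_orth[OF M] cl(2)[symmetric]
    using A closure_subset[of "range A"] by (auto simp: M_def nullspace_def)
  have a: "a = A"
    unfolding assms(5) cl by (rule ext) (rule block_id[OF M' N' A_op])
  have middle: "A \<circ> cadjoint A \<circ> A = A \<circ> cadjoint B \<circ> A \<longleftrightarrow> e = A"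
    unfolding e_def M_def N_def by (rule diamond_middle_iff[OF A B])
  have range1: "range A \<subseteq> range B \<longleftrightarrow> range c \<subseteq> range S" if "e = A"
    unfolding c_def M_def
  proof (rule range_subset_range_iff_shorted[OF A B N S[unfolded M_def]])
    show "block (orth (nullspace A)) (orth N) B = A" using that by (simp add: e_def M_def)
    show "block (nullspace A) (orth N) B = A \<circ> w" using w(2) that by (simp add: d_def M_def)
    show "S x = block (nullspace A) N B x - block (orth (nullspace A)) N B (w x)" for x
      by (simp add: S_eq assms(6) c_def M_def N_def)
  qed
  \<comment> \<open>The elimination lemma for \<open>cadjoint A\<close> and
    \<open>cadjoint B\<close>: \<open>M\<close> and \<open>N\<close> change places,
    \<open>cadjoint d\<close> takes the part of \<open>c\<close>, and \<open>z\<close> that of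
    \<open>w\<close>.\<close>
  have range2: "range (cadjoint A) \<subseteq> range (cadjoint B) \<longleftrightarrow> range (cadjoint d) \<subseteq> range (cadjoint S)"
    if "e = A"
  proof -
    have blocks: "cadjoint d = block (orth N) M (cadjoint B)"
      "cadjoint c = block N (orth M) (cadjoint B)"
      "cadjoint e = block (orth N) (orth M) (cadjoint B)"
      "cadjoint b22 = block N M (cadjoint B)"
      unfolding d_def c_def e_def assms(6) M_def[symmetric] N_def[symmetric]
      by (rule cadjoint_block[OF M N' B] cadjoint_block[OF M' N B] cadjoint_block[OF M' N' B]
          cadjoint_block[OF M N B])+
    show ?thesis
      unfolding blocks(1) N_def
    proof (rule range_subset_range_iff_shorted[OF A' B' M cadjoint_ops_between[OF M S, unfolded N_def]])
      show "block (orth (nullspace (cadjoint A))) (orth M) (cadjoint B) = cadjoint A"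
        using that blocks(3) by (simp add: N_def)
      show "block (nullspace (cadjoint A)) (orth M) (cadjoint B) = cadjoint A \<circ> z"
        using z(2) that blocks(2) by (simp add: N_def)
      show "cadjoint S v = block (nullspace (cadjoint A)) M (cadjoint B) v
          - block (orth (nullspace (cadjoint A))) M (cadjoint B) (z v)" for v
        using cadj_S[of v] blocks(1,4) by (simp add: N_def)
    qed
  qed
  have left: "diamond_le A B \<longleftrightarrow> e = A \<and> range c \<subseteq> range S \<and> range (cadjoint d) \<subseteq> range (cadjoint S)"
    unfolding diamond_le_def middle using range1 range2 by blast
  have c_iff: "range c \<subseteq> range S \<longleftrightarrow> (\<exists>y \<in> ops_between (orth M) M. c = S \<circ> y)"
    using douglas_ops_between[OF M c S] by (auto simp: image_comp[symmetric])
  \<comment> \<open>\<open>S\<close> stands on the right in d = x S, so Douglas is applied to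
    adjoints and \<open>x\<close> is the adjoint of the factor obtained.\<close>
  have d_iff: "range (cadjoint d) \<subseteq> range (cadjoint S) \<longleftrightarrow>
      (\<exists>x \<in> ops_between N (orth N). d = x \<circ> S)"
  proof
    assume "range (cadjoint d) \<subseteq> range (cadjoint S)"
    then obtain x' where x': "x' \<in> ops_between (orth N) N" "cadjoint d = cadjoint S \<circ> x'"
      using douglas_ops_between[OF N cadjoint_ops_between[OF M d] cadjoint_ops_between[OF M S]]
      by blast
    have "d = cadjoint (cadjoint S \<circ> x')" using cadjoint_cadjoint[OF db] x'(2) by simp
    also have "\<dots> = cadjoint x' \<circ> S"
      by (simp add: cadjoint_compose[OF bounded_clinear_cadjoint[OF ops_betweenD(1)[OF S]]
          ops_betweenD(1)[OF x'(1)]] cadjoint_cadjoint[OF ops_betweenD(1)[OF S]])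
    finally show "\<exists>x \<in> ops_between N (orth N). d = x \<circ> S"
      using cadjoint_ops_between[OF N' x'(1)] by blast
  next
    assume "\<exists>x \<in> ops_between N (orth N). d = x \<circ> S"
    then obtain x where x: "x \<in> ops_between N (orth N)" "d = x \<circ> S" by blast
    have "cadjoint d = cadjoint S \<circ> cadjoint x"
      unfolding x(2) by (rule cadjoint_compose[OF ops_betweenD(1)[OF x(1)] ops_betweenD(1)[OF S]])
    then show "range (cadjoint d) \<subseteq> range (cadjoint S)" by auto
  qed
  have right: "B = block_matrix a (x \<circ> S) (S \<circ> y) b22 \<longleftrightarrow> e = A \<and> d = x \<circ> S \<and> c = S \<circ> y"
    if "y \<in> ops_between (orth M) M" "x \<in> ops_between N (orth N)" for x y
    using block_matrix_iff[OF M N B A_op ops_between_compose[OF that(2) S]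
        ops_between_compose[OF S that(1)] b22]
    by (simp add: a c_def d_def e_def assms(6) M_def N_def)
  show ?thesis
    unfolding left c_iff d_iff cl M_def[symmetric] N_def[symmetric] using right by blast
qed

end
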